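(* Let $\Omega\subset\mathbb{R}^d$ be a bounded open set, let $\{\delta_k\}$ be a decreasing sequence with $\delta_k\to0$ and $\delta_k\le\delta_0$, and let $D=\Omega\cup\{\mathbf{y}\in\mathbb{R}^d\setminus\Omega:\operatorname{dist}(\mathbf{y},\partial\Omega)<\delta_0\}$. Let the kernels $\gamma_{\delta_k}$, the polytopes, $\underline{r}(n_{\delta_k})$ and $\gamma_{\delta_k,n_{\delta_k}}$ be as in the context, and assume $$\lim_{k\to\infty}\int_{\|\mathbf{z}\|_2\le\underline{r}(n_{\delta_k})}z_i^2\,\widetilde{\gamma}_{\delta_k}(\|\mathbf{z}\|_2)\,d\mathbf{z}=1,\qquad i=1,\dots,d.$$ Let $u\in H^1(D)$ be the extension by zero of a function in $H^1_0(\Omega)$. Then $$\lim_{k\to\infty}\int_D\int_D|u(\mathbf{y})-u(\mathbf{x})|^2\,\gamma_{\delta_k,n_{\delta_k}}(\mathbf{x},\mathbf{y})\,d\mathbf{y}\,d\mathbf{x}=\int_D|\nabla u(\mathbf{x})|^2\,d\mathbf{x},$$ i.e. $\lim_{k\to\infty}\|u\|_{\delta_k,n_{\delta_k}}^2=\int_D|\nabla u|^2\,d\mathbf{x}$.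
   Context: $B_\delta(\mathbf{x})=\{\mathbf{y}\in\mathbb{R}^d:\|\mathbf{y}-\mathbf{x}\|_2\le\delta\}$. Each kernel is $\gamma_\delta(\mathbf{x},\mathbf{y})=\widetilde{\gamma}_\delta(\|\mathbf{y}-\mathbf{x}\|_2)$ with $\widetilde{\gamma}_\delta\ge0$, $\widetilde{\gamma}_\delta(t)>0$ for $0\le t<\delta$, $\widetilde{\gamma}_\delta(t)=0$ for $t>\delta$, and $\int_{B_\delta(\mathbf{0})}z_i^2\widetilde{\gamma}_\delta(\|\mathbf{z}\|_2)d\mathbf{z}=1$ for $i=1,\dots,d$. For each $\delta$ and each point $\mathbf{x}$ a polytope $B_{\delta,n_{\delta,\mathbf{x}}}(\mathbf{x})\subset B_\delta(\mathbf{x})$ is given; $r_{\delta,\mathbf{x}}$ is the radius of the largest ball centered at $\mathbf{x}$ contained in it and $\underline{r}(n_\delta)=\inf_{\mathbf{x}\in\Omega}r_{\delta,\mathbf{x}}$. $\gamma_{\delta,n_{\delta,\mathbf{x}}}(\mathbf{x},\mathbf{y})=\gamma_\delta(\mathbf{x},\mathbf{y})$ if $\mathbf{y}\in B_{\delta,n_{\delta,\mathbf{x}}}(\mathbf{x})$ and $0$ otherwise; $\gamma_{\delta,n_\delta}(\mathbf{x},\mathbf{y})=\tfrac12(\gamma_{\delta,n_{\delta,\mathbf{x}}}(\mathbf{x},\mathbf{y})+\gamma_{\delta,n_{\delta,\mathbf{y}}}(\mathbf{y},\mathbf{x}))$. *)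

theory Defs
  imports "HOL-Analysis.Analysis"
begin

definition partial :: "'a::euclidean_space \<Rightarrow> ('a \<Rightarrow> real) \<Rightarrow> 'a \<Rightarrow> real" where
  "partial i f x = frechet_derivative f (at x) i"

definition grad :: "('a::euclidean_space \<Rightarrow> real) \<Rightarrow> 'a \<Rightarrow> 'a" where
  "grad f x = (\<Sum>i\<in>Basis. partial i f x *\<^sub>R i)"

definition smooth :: "('a::euclidean_space \<Rightarrow> real) \<Rightarrow> bool" where
  "smooth f \<longleftrightarrow> (\<forall>is. set is \<subseteq> Basis \<longrightarrow> (foldr partial is f) differentiable_on UNIV)"

definition test_function :: "'a::euclidean_space set \<Rightarrow> ('a \<Rightarrow> real) \<Rightarrow> bool" where
  "test_function U \<phi> \<longleftrightarrow> smooth \<phi> \<and> compact (closure {x. \<phi> x \<noteq> 0})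
      \<and> closure {x. \<phi> x \<noteq> 0} \<subseteq> U"

definition H1_weak_grad :: "'a::euclidean_space set \<Rightarrow> ('a \<Rightarrow> real) \<Rightarrow> ('a \<Rightarrow> 'a) \<Rightarrow> bool" where
  "H1_weak_grad U u g \<longleftrightarrow>
     u \<in> borel_measurable lborel \<and> g \<in> borel_measurable lborel \<and>
     (\<integral>\<^sup>+x\<in>U. ennreal ((u x)\<^sup>2) \<partial>lborel) < \<infinity> \<and>
     (\<integral>\<^sup>+x\<in>U. ennreal ((norm (g x))\<^sup>2) \<partial>lborel) < \<infinity> \<and>
     (\<forall>\<phi>. test_function U \<phi> \<longrightarrow> (\<forall>i\<in>Basis.
        (LINT x:U|lborel. u x * partial i \<phi> x) = - (LINT x:U|lborel. (g x \<bullet> i) * \<phi> x)))"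

definition H10 :: "'a::euclidean_space set \<Rightarrow> ('a \<Rightarrow> real) \<Rightarrow> bool" where
  "H10 U v \<longleftrightarrow> v \<in> borel_measurable lborel \<and>
     (\<exists>\<phi> w. (\<forall>n. test_function U (\<phi> n)) \<and> w \<in> borel_measurable lborel \<and>
        (\<lambda>n. \<integral>\<^sup>+x\<in>U. ennreal ((\<phi> n x - v x)\<^sup>2) \<partial>lborel) \<longlonglongrightarrow> 0 \<and>
        (\<lambda>n. \<integral>\<^sup>+x\<in>U. ennreal ((norm (grad (\<phi> n) x - w x))\<^sup>2) \<partial>lborel) \<longlonglongrightarrow> 0)"

definition inradius :: "'a::euclidean_space set \<Rightarrow> 'a \<Rightarrow> real" where
  "inradius S x = Sup {r. 0 \<le> r \<and> ball x r \<subseteq> S}"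

definition rlow :: "'a::euclidean_space set \<Rightarrow> ('a \<Rightarrow> 'a set) \<Rightarrow> real" where
  "rlow \<Omega> P = Inf ((\<lambda>x. inradius (P x) x) ` \<Omega>)"

definition trunc_kernel :: "(real \<Rightarrow> real) \<Rightarrow> ('a::euclidean_space \<Rightarrow> 'a set) \<Rightarrow> 'a \<Rightarrow> 'a \<Rightarrow> real" where
  "trunc_kernel \<gamma> P x y = (if y \<in> P x then \<gamma> (norm (y - x)) else 0)"

definition sym_kernel :: "(real \<Rightarrow> real) \<Rightarrow> ('a::euclidean_space \<Rightarrow> 'a set) \<Rightarrow> 'a \<Rightarrow> 'a \<Rightarrow> real" where
  "sym_kernel \<gamma> P x y = (trunc_kernel \<gamma> P x y + trunc_kernel \<gamma> P y x) / 2"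

end

theory Submission
  imports Defs
begin

text \<open>
  The zero extension \<open>u\<close> of an \<open>H\<^sup>1\<^sub>0\<close> function is differentiable in the mean square sense:
  \<open>\<parallel>u(\<cdot> + z) - u - w \<cdot> z\<parallel> = o(|z|)\<close> in \<open>L\<^sup>2\<close>, where \<open>w\<close> is the limit of the gradients of the
  approximating test functions. Since the kernels concentrate at the origin and have the identity as
  second moment matrix (the off-diagonal entries vanish by reflection), the energy of the full kernel
  differs from that of the linearization, which is exactly \<open>\<parallel>w\<parallel>\<^sup>2\<close>, by an arbitrarily small amount.
  From below, the polytopal kernel dominates on \<open>\<Omega> \<times> \<Omega>\<close> the kernel truncated at the inner radius,
  whose second moments tend to one; restricting to points at distance at least \<open>\<eta>\<close> from the complement
  of \<open>\<Omega>\<close> avoids the boundary, where the polytopes are not controlled. Finally \<open>w\<close> is the weak gradient \<open>g\<close>: mean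
  square differentiability of \<open>u\<close> and of a test function yields integration by parts by translation
  invariance, and the products of smooth bumps exp(-1/q) separate \<open>L\<^sup>2\<close> functions.
\<close>

section \<open>Smooth bump functions on boxes\<close>

text \<open>Zero extension makes the test functions of \<open>\<Omega>\<close> smooth on the whole
  space, so every translation \<open>x + z\<close> makes sense without regularity of the boundary.
  The linearization error passes from test functions to \<open>u\<close> because increments are
  bounded in mean square by \<open>norm z\<close> times the gradient norm: approximation in the
  gradient norm costs an error of order \<open>norm z\<close>, whereas closeness of the functions
  alone would give nothing after division by \<open>norm z\<close>. The energies are compared
  through \<open>a^2 <= (1 + \<tau>) * b^2 + (1 + 1 / \<tau>) * (a - b)^2\<close>. A linearization
  error of relative size \<open>\<tau>^2\<close> absorbs the factor \<open>1 + 1 / \<tau>\<close>,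
  and exchanging \<open>a\<close> and \<open>b\<close> gives the opposite bound.
  \<open>smooth\<close> demands all iterated partials, so the separating test functions come from a
  family stable under partial differentiation. Boxes generate the Borel sets and are stable under
  intersection; hence bumps converging to indicators of boxes suffice.\<close>

text \<open>For fixed \<open>q\<close> these functions are closed under differentiation.\<close>

definition flat_exp :: "real poly \<Rightarrow> real poly \<Rightarrow> nat \<Rightarrow> real \<Rightarrow> real" where
  "flat_exp q p m t = (if poly q t > 0 then poly p t / poly q t ^ m * exp (- 1 / poly q t) else 0)"

text \<open>Raise \<open>x / n \<le> exp (x / n)\<close> to the \<open>n\<close>-th power. At
  \<open>x = 1 / q\<close> this shows that \<open>exp (- 1 / q)\<close> vanishes faster than any
  power of \<open>q\<close> as \<open>q\<close> decreases to 0.\<close>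

lemma power_le_exp:
  fixes x :: real
  assumes "0 \<le> x"
  shows "x ^ n \<le> real n ^ n * exp x"
proof (cases "n = 0")
  case False
  have "x / n \<le> exp (x / n)"
    using exp_ge_add_one_self[of "x / n"] by linarith
  then have "(x / n) ^ n \<le> exp (x / n) ^ n"
    using assms by (intro power_mono) auto
  also have "\<dots> = exp x"
    using False by (simp add: exp_of_nat_mult[symmetric])
  finally show ?thesis
    using False by (simp add: power_divide field_simps)
qed (use assms in simp)

text \<open>At a zero \<open>t\<close> of \<open>q\<close> the factor \<open>s - t\<close> splits
  off, so \<open>q\<close> is of order \<open>s - t\<close>, while the exponential outweighs the
  denominator with two powers of \<open>q\<close> to spare. A quadratic bound makes the difference
  quotient at \<open>t\<close> tend to 0.\<close>

lemma flat_exp_quadratic_bound: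
  assumes "poly q t = 0"
  obtains C where "\<And>s. \<bar>s - t\<bar> \<le> 1 \<Longrightarrow> \<bar>flat_exp q p m s\<bar> \<le> C * (s - t)\<^sup>2"
proof -
  obtain r where r: "q = [:- t, 1:] * r"
    using assms poly_eq_0_iff_dvd by (metis dvdE)
  have "compact ((\<lambda>s. (poly p s, poly r s)) ` cball t 1)"
    by (intro compact_continuous_image continuous_intros) auto
  then obtain B where B: "\<And>s. s \<in> cball t 1 \<Longrightarrow> norm (poly p s, poly r s) \<le> B"
    by (meson compact_imp_bounded bounded_iff imageI)
  define M where "M = real (m + 2) ^ (m + 2)"
  have "\<bar>flat_exp q p m s\<bar> \<le> (B * (B\<^sup>2 * M)) * (s - t)\<^sup>2" if s: "\<bar>s - t\<bar> \<le> 1" for s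
  proof -
    have Bs: "\<bar>poly p s\<bar> \<le> B" "\<bar>poly r s\<bar> \<le> B"
      using B[of s] norm_fst_le[of "poly p s" "poly r s"] norm_snd_le[of "poly r s" "poly p s"] s
      by (auto simp: dist_real_def abs_minus_commute)
    have B0: "0 \<le> B" using Bs by linarith
    show ?thesis
    proof (cases "poly q s > 0")
      case True
      define v where "v = poly q s"
      have v: "v > 0" using True by (simp add: v_def)
      have "v = (s - t) * poly r s" by (simp add: v_def r algebra_simps)
      then have "v\<^sup>2 = (s - t)\<^sup>2 * (poly r s)\<^sup>2" by (simp add: power_mult_distrib)
      also have "\<dots> \<le> (s - t)\<^sup>2 * B\<^sup>2"
        using Bs B0 by (intro mult_left_mono) (auto simp: abs_le_square_iff[symmetric])
      finally have v2: "v\<^sup>2 \<le> (s - t)\<^sup>2 * B\<^sup>2" .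
      \<comment> \<open>Exponent \<open>m + 2\<close>: \<open>m\<close> powers cancel the
        denominator, the other two leave \<open>v\<^sup>2\<close>.\<close>
      have "(1 / v) ^ (m + 2) \<le> M * exp (1 / v)"
        unfolding M_def using v by (intro power_le_exp) auto
      then have "1 / v ^ m * exp (- 1 / v) \<le> M * v\<^sup>2"
        using v by (simp add: exp_minus field_simps power_add power2_eq_square)
      also have "\<dots> \<le> M * ((s - t)\<^sup>2 * B\<^sup>2)"
        using v2 by (intro mult_left_mono) (auto simp: M_def)
      finally have *: "1 / v ^ m * exp (- 1 / v) \<le> M * ((s - t)\<^sup>2 * B\<^sup>2)" .
      have "\<bar>flat_exp q p m s\<bar> = \<bar>poly p s\<bar> * (1 / v ^ m * exp (- 1 / v))"
        using v by (simp add: flat_exp_def v_def[symmetric] abs_mult)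
      also have "\<dots> \<le> B * (M * ((s - t)\<^sup>2 * B\<^sup>2))"
        by (rule mult_mono[OF Bs(1) *]) (use B0 v in auto)
      finally show ?thesis by (simp add: algebra_simps)
    next
      case False
      then show ?thesis using B0 by (simp add: flat_exp_def M_def)
    qed
  qed
  then show thesis by (rule that)
qed

text \<open>Where \<open>q > 0\<close>, this is the quotient and chain rule brought to the common
  denominator \<open>q ^ (m + 2)\<close>. Where \<open>q < 0\<close>, everything is locally 0. At a
  zero of \<open>q\<close> the quadratic bound gives derivative 0, which is also the value of the
  right-hand side there.\<close>

lemma flat_exp_deriv:
  "(flat_exp q p m has_real_derivative
     flat_exp q (pderiv p * q\<^sup>2 - smult (real m) (p * pderiv q * q) + p * pderiv q) (m + 2) t) (at t)"
    (is "(_ has_real_derivative ?D) _")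
proof -
  have op: "open {s. poly q s > 0}" "open {s. poly q s < 0}"
    by (intro open_Collect_less continuous_intros)+
  consider "poly q t > 0" | "poly q t < 0" | "poly q t = 0" by linarith
  then show ?thesis
  proof cases
    case 1
    have q: "((\<lambda>t. poly q t ^ m) has_real_derivative real m * poly q t ^ m / poly q t * poly (pderiv q) t) (at t)"
      using 1 by (intro DERIV_cong[OF DERIV_power[OF poly_DERIV]]) (cases m; simp add: field_simps)
    have e: "((\<lambda>t. exp (- 1 / poly q t)) has_real_derivative
        exp (- 1 / poly q t) * (poly (pderiv q) t / (poly q t)\<^sup>2)) (at t)"
      using 1 by (auto intro!: derivative_eq_intros simp: power2_eq_square)
    have "((\<lambda>t. poly p t / poly q t ^ m * exp (- 1 / poly q t)) has_real_derivative ?D) (at t)"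
      by (rule DERIV_cong[OF DERIV_mult[OF DERIV_divide[OF poly_DERIV q] e]])
        (use 1 in \<open>simp_all add: flat_exp_def field_simps power_add power2_eq_square\<close>)
    then show ?thesis
      by (rule has_field_derivative_transform_within_open[OF _ op(1)]) (use 1 in \<open>auto simp: flat_exp_def\<close>)
  next
    case 2
    have "((\<lambda>t. 0) has_real_derivative ?D) (at t)"
      using 2 by (auto simp: flat_exp_def)
    then show ?thesis
      by (rule has_field_derivative_transform_within_open[OF _ op(2)]) (use 2 in \<open>auto simp: flat_exp_def\<close>)
  next
    case 3
    obtain C where C: "\<And>s. \<bar>s - t\<bar> \<le> 1 \<Longrightarrow> \<bar>flat_exp q p m s\<bar> \<le> C * (s - t)\<^sup>2"
      using flat_exp_quadratic_bound[OF 3] by metis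
    have z: "flat_exp q p m t = 0" "?D = 0" using 3 by (auto simp: flat_exp_def)
    have "((\<lambda>s. (flat_exp q p m s - flat_exp q p m t) / (s - t)) \<longlongrightarrow> 0) (at t)"
    proof (rule tendsto_rabs_zero_cancel, rule tendsto_sandwich[of "\<lambda>_. 0" _ _ "\<lambda>s. C * \<bar>s - t\<bar>"])
      have "\<forall>\<^sub>F s in at t. \<bar>s - t\<bar> \<le> 1 \<and> s \<noteq> t"
        unfolding eventually_at by (intro exI[of _ 1]) (auto simp: dist_real_def)
      then show "\<forall>\<^sub>F s in at t. \<bar>(flat_exp q p m s - flat_exp q p m t) / (s - t)\<bar> \<le> C * \<bar>s - t\<bar>"
      proof eventually_elim
        case (elim s)
        then have "\<bar>flat_exp q p m s\<bar> \<le> C * \<bar>s - t\<bar> * \<bar>s - t\<bar>"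
          using C[of s] by (simp add: power2_eq_square mult.assoc abs_mult[symmetric])
        then show ?case using elim by (simp add: z abs_divide field_simps)
      qed
      show "((\<lambda>s. C * \<bar>s - t\<bar>) \<longlongrightarrow> 0) (at t)"
        by (auto intro!: tendsto_eq_intros)
    qed auto
    then show ?thesis unfolding has_field_derivative_iff z .
  qed
qed

definition flat_exp_prod ::
    "('a::euclidean_space \<Rightarrow> real poly) \<Rightarrow> ('a \<Rightarrow> real poly) \<Rightarrow> ('a \<Rightarrow> nat) \<Rightarrow> 'a \<Rightarrow> real" where
  "flat_exp_prod q p m x = (\<Prod>j\<in>Basis. flat_exp (q j) (p j) (m j) (x \<bullet> j))"

lemma flat_exp_prod_has_derivative:
  "(flat_exp_prod q p m has_derivative
     (\<lambda>y. \<Sum>i\<in>Basis. (y \<bullet> i) *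
        flat_exp (q i) (pderiv (p i) * (q i)\<^sup>2 - smult (real (m i)) (p i * pderiv (q i) * q i) + p i * pderiv (q i))
          (m i + 2) (x \<bullet> i) * (\<Prod>j\<in>Basis - {i}. flat_exp (q j) (p j) (m j) (x \<bullet> j)))) (at x)"
proof -
  have "((\<lambda>x. flat_exp (q i) (p i) (m i) (x \<bullet> i)) has_derivative (\<lambda>y. (y \<bullet> i) *
        flat_exp (q i) (pderiv (p i) * (q i)\<^sup>2 - smult (real (m i)) (p i * pderiv (q i) * q i) + p i * pderiv (q i))
          (m i + 2) (x \<bullet> i))) (at x)" for i
    using has_derivative_compose[OF bounded_linear_imp_has_derivative[OF bounded_linear_inner_left[of i]]
        flat_exp_deriv[THEN has_field_derivative_imp_has_derivative]]
    by (simp add: mult.commute)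
  from has_derivative_prod[OF this] show ?thesis
    unfolding flat_exp_prod_def[abs_def] .
qed

lemma partial_flat_exp_prod:
  assumes i: "i \<in> Basis"
  shows "partial i (flat_exp_prod q p m) = flat_exp_prod q
     (p(i := pderiv (p i) * (q i)\<^sup>2 - smult (real (m i)) (p i * pderiv (q i) * q i) + p i * pderiv (q i)))
     (m(i := m i + 2))"
proof
  fix x
  show "partial i (flat_exp_prod q p m) x = flat_exp_prod q
     (p(i := pderiv (p i) * (q i)\<^sup>2 - smult (real (m i)) (p i * pderiv (q i) * q i) + p i * pderiv (q i)))
     (m(i := m i + 2)) x"
    unfolding partial_def
      frechet_derivative_at[OF flat_exp_prod_has_derivative, symmetric] flat_exp_prod_def
    using i by (subst prod.remove[OF _ i])
      (auto simp: inner_Basis sum.remove[OF _ i] intro!: prod.cong sum.neutral split: if_splits)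
qed

text \<open>Every iterated partial is again a \<open>flat_exp_prod\<close> with the same
  \<open>q\<close>, only \<open>p\<close> and \<open>m\<close> change; hence it is
  differentiable.\<close>

lemma smooth_flat_exp_prod: "smooth (flat_exp_prod q p m)"
proof -
  have "\<exists>p' m'. foldr partial is (flat_exp_prod q p m) = flat_exp_prod q p' m'"
    if "set is \<subseteq> Basis" for "is"
    using that
  proof (induction "is")
    case (Cons i "is")
    then show ?case using partial_flat_exp_prod[of i q] by fastforce
  qed auto
  moreover have "flat_exp_prod q p' m' differentiable_on UNIV" for p' m'
    unfolding differentiable_on_def differentiable_def
    using flat_exp_prod_has_derivative by blast
  ultimately show ?thesis unfolding smooth_def by metis
qed

text \<open>The quadratic with zeros \<open>a \<bullet> j\<close> and \<open>b \<bullet> j\<close>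
  confines factor \<open>j\<close> to the side of the box, and the scale \<open>Suc n\<close>
  flattens \<open>exp (- 1 / q)\<close> towards 1 inside.\<close>

definition box_bump :: "'a::euclidean_space \<Rightarrow> 'a \<Rightarrow> nat \<Rightarrow> 'a \<Rightarrow> real" where
  "box_bump a b n =
     flat_exp_prod (\<lambda>j. smult (real (Suc n)) ([:- (a \<bullet> j), 1:] * [:b \<bullet> j, - 1:])) (\<lambda>_. 1) (\<lambda>_. 0)"

text \<open>Nonemptiness fixes the sign of the quadratic: if
  \<open>b \<bullet> j < a \<bullet> j\<close>, it would be positive between these two
  values.\<close>

lemma box_bump_eq:
  assumes "box a b \<noteq> {}"
  shows "box_bump a b n x =
    indicator (box a b) x * (\<Prod>j\<in>Basis. exp (- (1 / real (Suc n)) / ((x \<bullet> j - a \<bullet> j) * (b \<bullet> j - x \<bullet> j))))"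
proof -
  have ab: "a \<bullet> j < b \<bullet> j" if "j \<in> Basis" for j
    using assms that by (auto simp: box_ne_empty)
  have q: "poly (smult (real (Suc n)) ([:- (a \<bullet> j), 1:] * [:b \<bullet> j, - 1:])) t
      = real (Suc n) * ((t - a \<bullet> j) * (b \<bullet> j - t))" for t j
    by (simp add: algebra_simps)
  have pos: "0 < real (Suc n) * ((t - a \<bullet> j) * (b \<bullet> j - t)) \<longleftrightarrow> a \<bullet> j < t \<and> t < b \<bullet> j" if "j \<in> Basis" for t j
    using ab[OF that] by (auto simp: zero_less_mult_iff)
  show ?thesis
  proof (cases "x \<in> box a b")
    case True
    then show ?thesis
      unfolding box_bump_def flat_exp_prod_def flat_exp_def q
      by (auto simp: pos mem_box intro!: prod.cong)
  next
    case False
    then obtain j where "j \<in> Basis" "\<not> (a \<bullet> j < x \<bullet> j \<and> x \<bullet> j < b \<bullet> j)"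
      by (auto simp: mem_box)
    then show ?thesis using False
      unfolding box_bump_def flat_exp_prod_def flat_exp_def q
      by (auto simp del: of_nat_Suc simp: pos intro!: prod_zero bexI[of _ j])
  qed
qed

lemma test_function_box_bump:
  assumes "box a b \<noteq> {}" "cbox a b \<subseteq> U"
  shows "test_function U (box_bump a b n)"
proof -
  have "{x. box_bump a b n x \<noteq> 0} = box a b"
    using assms by (auto simp: box_bump_eq split: split_indicator)
  then show ?thesis
    using assms smooth_flat_exp_prod by (simp add: test_function_def closure_box box_bump_def)
qed

text \<open>Covers \<open>c = 0\<close> too, since division by 0 gives 0: the denominators in the
  bumps vanish on the hyperplanes that carry the faces of the box.\<close>

lemma tendsto_divide_const:
  fixes f :: "_ \<Rightarrow> real"
  assumes "(f \<longlongrightarrow> l) F"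
  shows "((\<lambda>x. f x / c) \<longlongrightarrow> l / c) F"
  using tendsto_mult_right[OF assms, of "inverse c"] by (simp add: divide_inverse)

lemma box_bump_tendsto:
  assumes "box a b \<noteq> {}"
  shows "(\<lambda>n. box_bump a b n x) \<longlonglongrightarrow> indicator (box a b) x"
proof -
  have "(\<lambda>n. indicator (box a b) x * (\<Prod>j\<in>Basis. exp (- (1 / real (Suc n)) / ((x \<bullet> j - a \<bullet> j) * (b \<bullet> j - x \<bullet> j)))))
     \<longlonglongrightarrow> indicator (box a b) x * (\<Prod>j\<in>(Basis::'a set). exp (- 0 / ((x \<bullet> j - a \<bullet> j) * (b \<bullet> j - x \<bullet> j))))"
    by (intro tendsto_mult tendsto_const tendsto_prod tendsto_exp tendsto_divide_const tendsto_minus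
        LIMSEQ_Suc[OF lim_1_over_n])
  then show ?thesis using assms by (simp add: box_bump_eq)
qed

lemma box_bump_bounds:
  assumes "box a b \<noteq> {}"
  shows "0 \<le> box_bump a b n x" "box_bump a b n x \<le> indicator (box a b) x"
proof -
  have "(\<Prod>j\<in>Basis. exp (- (1 / real (Suc n)) / ((x \<bullet> j - a \<bullet> j) * (b \<bullet> j - x \<bullet> j)))) \<le> 1" if "x \<in> box a b"
    using that by (intro prod_le_1) (auto simp: mem_box divide_le_0_iff)
  then show "box_bump a b n x \<le> indicator (box a b) x"
    using assms by (auto simp: box_bump_eq split: split_indicator)
  show "0 \<le> box_bump a b n x"
    using assms by (auto simp: box_bump_eq intro!: prod_nonneg mult_nonneg_nonneg)
qed

lemma box_bump_measurable [measurable]: "box_bump a b n \<in> borel_measurable borel"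
  unfolding box_bump_def
  by (intro borel_measurable_continuous_onI differentiable_imp_continuous_on
      smooth_flat_exp_prod[unfolded smooth_def, rule_format, of "[]", simplified])

section \<open>The fundamental lemma of the calculus of variations\<close>

text \<open>Dominated convergence along the bumps, which stay below the indicator of the box. The
  closed box lies in \<open>D\<close>, so the bumps are test functions of \<open>D\<close>.\<close>

lemma integral_box_eq_0:
  fixes f :: "'a::euclidean_space \<Rightarrow> real"
  assumes f [measurable]: "f \<in> borel_measurable lborel"
    and f_int: "set_integrable lborel (cbox a b) f"
    and orth: "\<And>\<psi>. test_function D \<psi> \<Longrightarrow> (LINT x:D|lborel. f x * \<psi> x) = 0"
    and ab: "cbox a b \<subseteq> D"
  shows "(LINT x:box a b|lborel. f x) = 0"
proof (cases "box a b = {}")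
  case True
  then show ?thesis by (simp add: set_lebesgue_integral_def)
next
  case False
  have sub: "box a b \<subseteq> D" using ab box_subset_cbox by blast
  have bump: "(LINT x|lborel. f x * box_bump a b n x) = 0" for n
  proof -
    have "(LINT x|lborel. f x * box_bump a b n x) = (LINT x:D|lborel. f x * box_bump a b n x)"
      unfolding set_lebesgue_integral_def using sub
      by (intro Bochner_Integration.integral_cong) (auto simp: box_bump_eq[OF False] split: split_indicator)
    then show ?thesis using orth[OF test_function_box_bump[OF False ab]] by simp
  qed
  have "(\<lambda>n. LINT x|lborel. f x * box_bump a b n x) \<longlonglongrightarrow> (LINT x|lborel. f x * indicator (box a b) x)"
  proof (rule integral_dominated_convergence)
    show "integrable lborel (\<lambda>x. \<bar>indicator (cbox a b) x *\<^sub>R f x\<bar>)"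
      using f_int unfolding set_integrable_def by (rule integrable_abs)
    show "AE x in lborel. norm (f x * box_bump a b n x) \<le> \<bar>indicator (cbox a b) x *\<^sub>R f x\<bar>" for n
    proof (rule AE_I2)
      fix x
      have "\<bar>f x\<bar> * box_bump a b n x \<le> \<bar>f x\<bar> * indicator (box a b) x"
        using box_bump_bounds[OF False] by (intro mult_left_mono) auto
      also have "\<dots> \<le> \<bar>f x\<bar> * indicator (cbox a b) x"
        using box_subset_cbox[of a b] by (auto split: split_indicator)
      finally show "norm (f x * box_bump a b n x) \<le> \<bar>indicator (cbox a b) x *\<^sub>R f x\<bar>"
        using box_bump_bounds(1)[OF False] by (simp add: abs_mult mult.commute)
    qed
    show "AE x in lborel. (\<lambda>n. f x * box_bump a b n x) \<longlonglongrightarrow> f x * indicator (box a b) x"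
      by (intro AE_I2 tendsto_mult_left box_bump_tendsto False)
  qed measurable
  then have "(LINT x|lborel. f x * indicator (box a b) x) = 0"
    by (simp add: bump LIMSEQ_const_iff)
  then show ?thesis by (simp add: set_lebesgue_integral_def mult.commute)
qed

text \<open>The positive and the negative part of \<open>F\<close> are densities of two finite
  measures that agree on boxes, an intersection-stable generator. So the measures coincide, and then
  the densities almost everywhere.\<close>

lemma AE_zero_if_box_integrals_zero:
  fixes F :: "'a::euclidean_space \<Rightarrow> real"
  assumes F: "integrable lborel F" and box: "\<And>c d. (LINT x:box c d|lborel. F x) = 0"
  shows "AE x in lborel. F x = 0"
proof -
  have F_meas [measurable]: "F \<in> borel_measurable borel"
    using borel_measurable_integrable[OF F] by simp
  \<comment> \<open>\<open>ennreal\<close> cuts negative values off at 0, so \<open>M\<close> and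
    \<open>N\<close> carry exactly the positive and the negative part.\<close>
  define M where "M = density lborel (\<lambda>x. ennreal (F x))"
  define N where "N = density lborel (\<lambda>x. ennreal (- F x))"
  have fin: "(\<integral>\<^sup>+x. ennreal (F x) \<partial>lborel) < \<infinity>" "(\<integral>\<^sup>+x. ennreal (- F x) \<partial>lborel) < \<infinity>"
    using F unfolding real_integrable_def by (auto simp: top.not_eq_extremum)
  have eq: "emeasure M X = emeasure N X" if "X \<in> range (\<lambda>(a, b). box a b)" for X
  proof -
    obtain c d where X: "X = box c d" using \<open>X \<in> _\<close> by auto
    then have X_meas: "X \<in> sets borel" by simp
    have int: "integrable lborel (\<lambda>x. indicator X x *\<^sub>R F x)"
      using F by (intro integrable_mult_indicator) (auto simp: X)
    have *: "ennreal (F x) * indicator X x = ennreal (indicator X x *\<^sub>R F x)"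
      "ennreal (- F x) * indicator X x = ennreal (- (indicator X x *\<^sub>R F x))" for x
      by (auto split: split_indicator)
    have "enn2real (\<integral>\<^sup>+x. ennreal (indicator X x *\<^sub>R F x) \<partial>lborel)
        = enn2real (\<integral>\<^sup>+x. ennreal (- (indicator X x *\<^sub>R F x)) \<partial>lborel)"
      using box[of c d] unfolding set_lebesgue_integral_def X[symmetric] real_lebesgue_integral_def[OF int]
      by simp
    moreover have "(\<integral>\<^sup>+x. ennreal (indicator X x *\<^sub>R F x) \<partial>lborel) < \<infinity>"
      "(\<integral>\<^sup>+x. ennreal (- (indicator X x *\<^sub>R F x)) \<partial>lborel) < \<infinity>"
      using int unfolding real_integrable_def by (auto simp: top.not_eq_extremum)
    ultimately have "(\<integral>\<^sup>+x. ennreal (indicator X x *\<^sub>R F x) \<partial>lborel)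
        = (\<integral>\<^sup>+x. ennreal (- (indicator X x *\<^sub>R F x)) \<partial>lborel)"
      by (metis ennreal_enn2real infinity_ennreal_def)
    then show ?thesis
      unfolding M_def N_def by (subst (1 2) emeasure_density) (auto simp: * X_meas simp del: real_scaleR_def)
  qed
  have "M = N"
  proof (rule measure_eqI_generator_eq[where E = "range (\<lambda>(a, b). box a b)" and \<Omega> = UNIV
        and A = "\<lambda>n::nat. box (- (real n *\<^sub>R One)) (real n *\<^sub>R One)"])
    show "Int_stable (range (\<lambda>(a, b). box a b :: 'a set))"
      by (auto simp: Int_stable_def box_Int_box)
    show "sets M = sigma_sets UNIV (range (\<lambda>(a, b). box a b))"
      "sets N = sigma_sets UNIV (range (\<lambda>(a, b). box a b))"
      by (simp_all add: M_def N_def borel_eq_box)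
    show "emeasure M (box (- (real n *\<^sub>R One)) (real n *\<^sub>R One)) \<noteq> \<infinity>" for n
    proof -
      have "emeasure M (box (- (real n *\<^sub>R One)) (real n *\<^sub>R One)) \<le> (\<integral>\<^sup>+x. ennreal (F x) \<partial>lborel)"
        unfolding M_def by (subst emeasure_density) (auto intro!: nn_integral_mono split: split_indicator)
      then show ?thesis using fin by (auto simp: top_unique)
    qed
  qed (use UN_box_eq_UNIV eq in auto)
  then have "AE x in lborel. ennreal (F x) = ennreal (- F x)"
    using fin unfolding M_def N_def by (subst (asm) finite_density_unique) auto
  \<comment> \<open>At least one of \<open>ennreal (F x)\<close> and \<open>ennreal (- F x)\<close>
    is 0, so equality makes both 0.\<close>
  then show ?thesis
    by eventually_elim (metis ennreal_eq_0_iff ennreal_neg linorder_le_cases neg_le_0_iff_le order_antisym)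
qed

text \<open>\<open>f\<close> is integrable only on closed boxes in \<open>D\<close>, so it is cut
  off to one box at a time; the intersection of any box with that one is a box on which the integral
  is known to vanish. Countably many closed boxes cover \<open>D\<close>, so the exceptional sets
  add up to a null set.\<close>

lemma AE_zero_if_orthogonal_to_test_functions:
  fixes f :: "'a::euclidean_space \<Rightarrow> real"
  assumes D: "open D"
    and f [measurable]: "f \<in> borel_measurable lborel"
    and f_int: "\<And>a b. cbox a b \<subseteq> D \<Longrightarrow> set_integrable lborel (cbox a b) f"
    and orth: "\<And>\<psi>. test_function D \<psi> \<Longrightarrow> (LINT x:D|lborel. f x * \<psi> x) = 0"
  shows "AE x in lborel. x \<in> D \<longrightarrow> f x = 0"
proof -
  have ae: "AE x in lborel. x \<in> cbox a b \<longrightarrow> f x = 0" if ab: "cbox a b \<subseteq> D" for a b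
  proof -
    have null: "cbox a b - box a b \<in> null_sets lborel"
      using negligible_frontier_interval[of a b]
      by (subst null_sets_completion_iff[symmetric]) (auto simp: negligible_iff_null_sets)
    have sub: "box a b \<inter> box c d \<subseteq> cbox a b" for c d using box_subset_cbox[of a b] by auto
    have "AE x in lborel. indicator (box a b) x *\<^sub>R f x = 0"
    proof (rule AE_zero_if_box_integrals_zero)
      show "integrable lborel (\<lambda>x. indicator (box a b) x *\<^sub>R f x)"
        using set_integrable_subset[OF f_int[OF ab] _ box_subset_cbox[of a b]]
        by (simp add: set_integrable_def)
      fix c d :: 'a
      obtain c' d' where cd: "box a b \<inter> box c d = box c' d'" using box_Int_box by blast
      have "(LINT x:box c' d'|lborel. f x) = 0"
      proof (cases "box c' d' = {}")
        case True
        then show ?thesis by (simp add: set_lebesgue_integral_def)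
      next
        case False
        have "cbox c' d' \<subseteq> cbox a b"
          using closure_mono[OF sub[of c d]] False by (simp add: cd closure_box)
        then show ?thesis
          using set_integrable_subset[OF f_int[OF ab], of "cbox c' d'"] ab
          by (intro integral_box_eq_0[OF f _ orth]) auto
      qed
      also have "(LINT x:box c' d'|lborel. f x) = (LINT x:box c d|lborel. indicator (box a b) x *\<^sub>R f x)"
        unfolding set_lebesgue_integral_def cd[symmetric]
        by (intro Bochner_Integration.integral_cong) (auto split: split_indicator)
      finally show "(LINT x:box c d|lborel. indicator (box a b) x *\<^sub>R f x) = 0" .
    qed
    with AE_not_in[OF null] show ?thesis
      by eventually_elim (auto split: split_indicator_asm)
  qed
  obtain \<D> where \<D>: "countable \<D>" "\<D> \<subseteq> Pow D" "\<And>X. X \<in> \<D> \<Longrightarrow> \<exists>a b. X = cbox a b" "\<Union>\<D> = D"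
    using open_countable_Union_open_cbox[OF D] by metis
  have "AE x in lborel. \<forall>X\<in>\<D>. x \<in> X \<longrightarrow> f x = 0"
    unfolding AE_ball_countable[OF \<D>(1)] using \<D>(2,3) ae by (metis PowD subsetD)
  then show ?thesis
    by eventually_elim (use \<D>(4) in auto)
qed

section \<open>Differentiability in mean square\<close>

definition L2sq :: "('a::euclidean_space \<Rightarrow> 'b::euclidean_space) \<Rightarrow> ennreal" where
  "L2sq f = (\<integral>\<^sup>+x. ennreal ((norm (f x))\<^sup>2) \<partial>lborel)"

section \<open>Quadratic triangle inequalities and translation invariance\<close>

lemma norm_add_power2_le:
  fixes a b :: "'a::real_normed_vector"
  shows "(norm (a + b))\<^sup>2 \<le> 2 * (norm a)\<^sup>2 + 2 * (norm b)\<^sup>2"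
proof -
  have "(norm (a + b))\<^sup>2 \<le> (norm a + norm b)\<^sup>2"
    by (intro power_mono norm_triangle_ineq) auto
  also have "\<dots> \<le> 2 * (norm a)\<^sup>2 + 2 * (norm b)\<^sup>2"
    using sum_squares_bound[of "norm a" "norm b"] by (simp add: power2_sum)
  finally show ?thesis .
qed

lemma L2sq_add:
  assumes [measurable]: "f \<in> borel_measurable borel" "g \<in> borel_measurable borel"
  shows "L2sq (\<lambda>x. f x + g x) \<le> 2 * L2sq f + 2 * L2sq g"
proof -
  have "L2sq (\<lambda>x. f x + g x) \<le> (\<integral>\<^sup>+x. 2 * ennreal ((norm (f x))\<^sup>2) + 2 * ennreal ((norm (g x))\<^sup>2) \<partial>lborel)"
    unfolding L2sq_def
  proof (intro nn_integral_mono)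
    fix x
    show "ennreal ((norm (f x + g x))\<^sup>2) \<le> 2 * ennreal ((norm (f x))\<^sup>2) + 2 * ennreal ((norm (g x))\<^sup>2)"
      using norm_add_power2_le[of "f x" "g x"]
      by (simp add: ennreal_mult'[symmetric] ennreal_plus[symmetric] ennreal_numeral[symmetric] ennreal_leI del: ennreal_plus ennreal_numeral)
  qed
  also have "\<dots> = 2 * L2sq f + 2 * L2sq g"
    unfolding L2sq_def by (simp add: nn_integral_add nn_integral_cmult)
  finally show ?thesis .
qed

lemma L2sq_minus_commute: "L2sq (\<lambda>x. f x - g x) = L2sq (\<lambda>x. g x - f x)"
  by (simp add: L2sq_def norm_minus_commute)

lemma L2sq_diff:
  assumes "f \<in> borel_measurable borel" "g \<in> borel_measurable borel"
  shows "L2sq (\<lambda>x. f x - g x) \<le> 2 * L2sq f + 2 * L2sq g"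
  using L2sq_add[of f "\<lambda>x. - g x"] assms by (simp add: L2sq_def)

lemma nn_integral_lborel_translate:
  fixes f :: "'a::euclidean_space \<Rightarrow> ennreal"
  assumes [measurable]: "f \<in> borel_measurable borel"
  shows "(\<integral>\<^sup>+x. f (x + z) \<partial>lborel) = (\<integral>\<^sup>+x. f x \<partial>lborel)"
  using nn_integral_distr[of "(+) z" lborel borel f] by (simp add: lborel_distr_plus add.commute[of z])

lemma L2sq_translate:
  assumes [measurable]: "f \<in> borel_measurable borel"
  shows "L2sq (\<lambda>x. f (x + z)) = L2sq f"
  unfolding L2sq_def by (rule nn_integral_lborel_translate[of "\<lambda>x. ennreal ((norm (f x))\<^sup>2)"]) measurable

lemma L2sq_inner_le:
  fixes f :: "'a::euclidean_space \<Rightarrow> 'b::euclidean_space"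
  assumes [measurable]: "f \<in> borel_measurable borel"
  shows "L2sq (\<lambda>x. f x \<bullet> z) \<le> ennreal ((norm z)\<^sup>2) * L2sq f"
proof -
  have "(f x \<bullet> z)\<^sup>2 \<le> (norm z)\<^sup>2 * (norm (f x))\<^sup>2" for x
    using Cauchy_Schwarz_ineq2[of "f x" z] abs_le_square_iff[of "f x \<bullet> z" "norm z * norm (f x)"]
    by (simp add: power_mult_distrib mult.commute)
  then have "L2sq (\<lambda>x. f x \<bullet> z) \<le> (\<integral>\<^sup>+x. ennreal ((norm z)\<^sup>2) * ennreal ((norm (f x))\<^sup>2) \<partial>lborel)"
    unfolding L2sq_def by (intro nn_integral_mono) (simp add: ennreal_mult'[symmetric] ennreal_leI)
  then show ?thesis by (simp add: L2sq_def nn_integral_cmult)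
qed

lemma L2sq_translate_diff_le:
  fixes f :: "'a::euclidean_space \<Rightarrow> 'b::euclidean_space"
  assumes [measurable]: "f \<in> borel_measurable borel"
  shows "L2sq (\<lambda>x. f (x + z) - f x) \<le> 4 * L2sq f"
proof -
  have "L2sq (\<lambda>x. f (x + z) - f x) \<le> 2 * L2sq (\<lambda>x. f (x + z)) + 2 * L2sq f"
    by (rule L2sq_diff) measurable
  then show ?thesis by (simp add: L2sq_translate distrib_right[symmetric])
qed

section \<open>Increments of continuously differentiable functions\<close>

lemma has_vector_derivative_along_segment:
  fixes v :: "'a::euclidean_space \<Rightarrow> real"
  assumes "\<And>x. (v has_derivative (\<lambda>y. G x \<bullet> y)) (at x)"
  shows "((\<lambda>t. v (x + t *\<^sub>R z)) has_vector_derivative G (x + t *\<^sub>R z) \<bullet> z) (at t within S)"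
proof -
  have "((\<lambda>t. x + t *\<^sub>R z) has_derivative (\<lambda>h. h *\<^sub>R z)) (at t within S)"
    by (auto intro!: derivative_eq_intros)
  from has_derivative_compose[OF this assms] show ?thesis
    by (simp add: has_vector_derivative_def)
qed

text \<open>Jensen's inequality for the square: the increment \<open>c\<close> is the mean of the
  slope \<open>h\<close> over the unit interval, and the integral of \<open>(h t - c)^2\<close> is
  nonnegative.\<close>

lemma increment_power2_le:
  fixes v :: "'a::euclidean_space \<Rightarrow> real"
  assumes dv: "\<And>x. (v has_derivative (\<lambda>y. G x \<bullet> y)) (at x)" and G: "continuous_on UNIV G"
  shows "ennreal ((v (x + z) - v x)\<^sup>2) \<le>
    (\<integral>\<^sup>+t. ennreal ((G (x + t *\<^sub>R z) \<bullet> z)\<^sup>2) * indicator {0..1} t \<partial>lborel)"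
proof -
  define h where "h t = G (x + t *\<^sub>R z) \<bullet> z" for t :: real
  define c where "c = v (x + z) - v x"
  have h_cont: "continuous_on {0..1} h"
    unfolding h_def by (intro continuous_intros continuous_on_compose2[OF G]) auto
  have h_int: "(h has_integral c) {0..1}"
    using fundamental_theorem_of_calculus[of 0 1 "\<lambda>t. v (x + t *\<^sub>R z)" h]
      has_vector_derivative_along_segment[OF dv]
    by (simp add: h_def c_def)
  have h2: "((\<lambda>t. (h t)\<^sup>2) has_integral integral {0..1} (\<lambda>t. (h t)\<^sup>2)) {0..1}"
    by (intro integrable_integral integrable_continuous_interval continuous_intros h_cont)
  have one: "((\<lambda>t::real. c\<^sup>2) has_integral c\<^sup>2) {0..1}"
    using has_integral_const_real[of "c\<^sup>2" 0 1] by simp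
  have "((\<lambda>t. (h t)\<^sup>2 - 2 * c * h t + c\<^sup>2) has_integral
      (integral {0..1} (\<lambda>t. (h t)\<^sup>2) - 2 * c * c + c\<^sup>2)) {0..1}"
    by (intro has_integral_add has_integral_diff has_integral_mult_right h2 h_int one)
  moreover have "(h t)\<^sup>2 - 2 * c * h t + c\<^sup>2 = (h t - c)\<^sup>2" for t
    by (simp add: power2_diff)
  ultimately have "0 \<le> integral {0..1} (\<lambda>t. (h t)\<^sup>2) - 2 * c * c + c\<^sup>2"
    by (metis (no_types, lifting) has_integral_nonneg zero_le_power2)
  then have "c\<^sup>2 \<le> integral {0..1} (\<lambda>t. (h t)\<^sup>2)"
    by (simp add: power2_eq_square)
  then show ?thesis
    using nn_integral_has_integral_lebesgue'[OF _ h2]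
    by (simp add: c_def h_def ennreal_leI)
qed

text \<open>After Tonelli, translation invariance removes the shift by \<open>t *\<^sub>R z\<close>,
  so averaging over the segment costs nothing.\<close>

lemma L2sq_increment_le:
  fixes v :: "'a::euclidean_space \<Rightarrow> real"
  assumes dv: "\<And>x. (v has_derivative (\<lambda>y. G x \<bullet> y)) (at x)" and G: "continuous_on UNIV G"
  shows "L2sq (\<lambda>x. v (x + z) - v x) \<le> ennreal ((norm z)\<^sup>2) * L2sq G"
proof -
  have [measurable]: "G \<in> borel_measurable borel"
    using G by (rule borel_measurable_continuous_onI)
  have "L2sq (\<lambda>x. v (x + z) - v x)
      \<le> (\<integral>\<^sup>+x. (\<integral>\<^sup>+t. ennreal ((G (x + t *\<^sub>R z) \<bullet> z)\<^sup>2) * indicator {0..1::real} t \<partial>lborel) \<partial>lborel)"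
    unfolding L2sq_def by (intro nn_integral_mono) (use increment_power2_le[OF dv G] in simp)
  also have "\<dots> = (\<integral>\<^sup>+t. (\<integral>\<^sup>+x. ennreal ((G (x + t *\<^sub>R z) \<bullet> z)\<^sup>2) * indicator {0..1::real} t \<partial>lborel) \<partial>lborel)"
    by (rule lborel_pair.Fubini') measurable
  also have "\<dots> = (\<integral>\<^sup>+t. L2sq (\<lambda>x. G x \<bullet> z) * indicator {0..1::real} t \<partial>lborel)"
    by (intro nn_integral_cong)
      (simp add: nn_integral_multc L2sq_def nn_integral_lborel_translate[of "\<lambda>x. ennreal ((G x \<bullet> z)\<^sup>2)"])
  also have "\<dots> = L2sq (\<lambda>x. G x \<bullet> z)"
    by (simp add: nn_integral_cmult_indicator)
  also have "\<dots> \<le> ennreal ((norm z)\<^sup>2) * L2sq G"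
    by (rule L2sq_inner_le) measurable
  finally show ?thesis .
qed

section \<open>Test functions and their gradients\<close>

lemma test_function_eq_0: "test_function U \<phi> \<Longrightarrow> x \<notin> U \<Longrightarrow> \<phi> x = 0"
  using closure_subset[of "{x. \<phi> x \<noteq> 0}"] by (auto simp: test_function_def)

lemma smooth_differentiable: "smooth \<phi> \<Longrightarrow> \<phi> differentiable at x"
  unfolding smooth_def differentiable_on_def by (erule allE[of _ "[]"]) simp

lemma smooth_has_derivative:
  assumes "smooth \<phi>"
  shows "(\<phi> has_derivative (\<lambda>y. grad \<phi> x \<bullet> y)) (at x)"
proof -
  have d: "(\<phi> has_derivative frechet_derivative \<phi> (at x)) (at x)"
    using smooth_differentiable[OF assms] frechet_derivative_works by blast
  then have "linear (frechet_derivative \<phi> (at x))"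
    by (rule has_derivative_linear)
  then have "frechet_derivative \<phi> (at x) (\<Sum>i\<in>Basis. (y \<bullet> i) *\<^sub>R i) = grad \<phi> x \<bullet> y" for y
    by (simp add: linear_sum linear_cmul grad_def partial_def inner_sum_left mult.commute inner_commute[of y])
  then have "frechet_derivative \<phi> (at x) = (\<lambda>y. grad \<phi> x \<bullet> y)"
    by (simp add: euclidean_representation fun_eq_iff)
  with d show ?thesis by simp
qed

lemma smooth_continuous_grad:
  fixes \<phi> :: "'a::euclidean_space \<Rightarrow> real"
  assumes "smooth \<phi>"
  shows "continuous_on UNIV (grad \<phi>)"
proof -
  have "continuous_on UNIV (partial i \<phi>)" if "i \<in> Basis" for i
    using assms[unfolded smooth_def, rule_format, of "[i]"] that
    by (intro differentiable_imp_continuous_on) simp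
  then show ?thesis unfolding grad_def[abs_def] by (intro continuous_intros) auto
qed

lemma grad_inner_Basis: "i \<in> Basis \<Longrightarrow> grad \<phi> x \<bullet> i = partial i \<phi> x"
  by (simp add: grad_def)

lemma test_function_grad_eq_0:
  assumes "test_function U \<phi>" "x \<notin> closure {x. \<phi> x \<noteq> 0}"
  shows "grad \<phi> x = 0"
proof -
  have "((\<lambda>_. 0::real) has_derivative (\<lambda>_. 0)) (at x)" by simp
  then have "(\<phi> has_derivative (\<lambda>_. 0)) (at x)"
    by (rule has_derivative_transform_within_open[of _ _ _ UNIV "- closure {x. \<phi> x \<noteq> 0}", simplified])
      (use assms closure_subset[of "{x. \<phi> x \<noteq> 0}"] in auto)
  then have "frechet_derivative \<phi> (at x) = (\<lambda>_. 0)"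
    by (metis frechet_derivative_at)
  then show ?thesis by (simp add: grad_def partial_def)
qed

lemma test_function_support:
  assumes "test_function U \<phi>"
  obtains R where "0 < R" "\<And>x. R < norm x \<Longrightarrow> \<phi> x = 0" "\<And>x. R < norm x \<Longrightarrow> grad \<phi> x = 0"
proof -
  have "bounded (closure {x. \<phi> x \<noteq> 0})"
    using assms unfolding test_function_def by (intro compact_imp_bounded) auto
  then obtain R where "0 < R" and R: "\<And>x. x \<in> closure {x. \<phi> x \<noteq> 0} \<Longrightarrow> norm x \<le> R"
    unfolding bounded_pos by auto
  moreover have "\<phi> x = 0" if "R < norm x" for x
    using R[of x] closure_subset[of "{x. \<phi> x \<noteq> 0}"] that by force
  moreover have "grad \<phi> x = 0" if "R < norm x" for x
    using R[of x] that test_function_grad_eq_0[OF assms] by force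
  ultimately show thesis using that by blast
qed

lemma L2sq_finite_if_compact_support:
  fixes f :: "'a::euclidean_space \<Rightarrow> 'b::euclidean_space"
  assumes f: "continuous_on UNIV f" and R: "\<And>x. R < norm x \<Longrightarrow> f x = 0"
  shows "L2sq f < \<infinity>"
proof -
  have "compact (f ` cball 0 R)"
    by (intro compact_continuous_image continuous_on_subset[OF f]) auto
  then obtain B where B: "\<And>x. x \<in> cball 0 R \<Longrightarrow> norm (f x) \<le> B"
    by (meson compact_imp_bounded bounded_iff imageI)
  have "L2sq f \<le> (\<integral>\<^sup>+x. ennreal (B\<^sup>2) * indicator (cball (0::'a) R) x \<partial>lborel)"
    unfolding L2sq_def
  proof (intro nn_integral_mono)
    fix x
    show "ennreal ((norm (f x))\<^sup>2) \<le> ennreal (B\<^sup>2) * indicator (cball 0 R) x"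
    proof (cases "x \<in> cball 0 R")
      case True
      then show ?thesis using B[OF True] by (simp add: ennreal_leI power_mono)
    next
      case False
      then show ?thesis using R[of x] by simp
    qed
  qed
  also have "\<dots> < \<infinity>"
    using emeasure_bounded_finite[of "cball 0 R :: 'a set"]
    by (simp add: nn_integral_cmult_indicator ennreal_mult_less_top)
  finally show ?thesis .
qed

section \<open>Mean square differentiability, first of test functions, then of their limits\<close>

definition L2_differentiable :: "('a::euclidean_space \<Rightarrow> real) \<Rightarrow> ('a \<Rightarrow> 'a) \<Rightarrow> bool" where
  "L2_differentiable u w \<longleftrightarrow> (\<forall>\<epsilon>>0. \<exists>\<eta>>0. \<forall>z. norm z < \<eta> \<longrightarrow>
     L2sq (\<lambda>x. u (x + z) - u x - w x \<bullet> z) \<le> ennreal (\<epsilon> * (norm z)\<^sup>2))"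

lemma linearization_error_le:
  fixes v :: "'a::euclidean_space \<Rightarrow> real"
  assumes dv: "\<And>x. (v has_derivative (\<lambda>y. G x \<bullet> y)) (at x)"
    and B: "\<And>t. t \<in> {0..1} \<Longrightarrow> norm (G (x + t *\<^sub>R z) - G x) \<le> B"
  shows "\<bar>v (x + z) - v x - G x \<bullet> z\<bar> \<le> B * norm z"
proof -
  have "\<exists>t\<in>{0<..<1}. v (x + 1 *\<^sub>R z) - v (x + 0 *\<^sub>R z) = (1 - 0) * (G (x + t *\<^sub>R z) \<bullet> z)"
    using has_vector_derivative_along_segment[OF dv, unfolded has_vector_derivative_def]
    by (intro mvt_simple[where f'="\<lambda>t h. h * (G (x + t *\<^sub>R z) \<bullet> z)"]) (auto simp: mult.commute)
  then obtain t where t: "t \<in> {0<..<1}" "v (x + z) - v x = G (x + t *\<^sub>R z) \<bullet> z" by auto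
  then have "\<bar>v (x + z) - v x - G x \<bullet> z\<bar> = \<bar>(G (x + t *\<^sub>R z) - G x) \<bullet> z\<bar>"
    by (simp add: inner_diff_left)
  also have "\<dots> \<le> norm (G (x + t *\<^sub>R z) - G x) * norm z" by (rule Cauchy_Schwarz_ineq2)
  also have "\<dots> \<le> B * norm z" using B[of t] t(1) by (intro mult_right_mono) auto
  finally show ?thesis .
qed

lemma L2_differentiable_test_function:
  fixes \<phi> :: "'a::euclidean_space \<Rightarrow> real"
  assumes "test_function U \<phi>"
  shows "L2_differentiable \<phi> (grad \<phi>)"
  unfolding L2_differentiable_def
proof (intro allI impI)
  fix \<epsilon> :: real assume "\<epsilon> > 0"
  have sm: "smooth \<phi>" using assms by (simp add: test_function_def)
  obtain R where R: "0 < R" "\<And>x. R < norm x \<Longrightarrow> \<phi> x = 0" "\<And>x. R < norm x \<Longrightarrow> grad \<phi> x = 0"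
    using test_function_support[OF assms] by metis
  define M where "M = measure lborel (cball (0::'a) (R + 1))"
  have M: "emeasure lborel (cball (0::'a) (R + 1)) = ennreal M" "0 \<le> M"
    using emeasure_bounded_finite[of "cball (0::'a) (R + 1)"]
    by (simp_all add: M_def emeasure_eq_ennreal_measure less_top[symmetric])
  \<comment> \<open>The error will be at most \<open>e * norm z\<close> on a ball of volume
    \<open>M\<close>, so its square integrates to at most
    \<open>e\<^sup>2 * M * (norm z)\<^sup>2\<close>.\<close>
  define e where "e = sqrt (\<epsilon> / (M + 1))"
  have e: "e > 0" "e\<^sup>2 * M \<le> \<epsilon>"
    using \<open>\<epsilon> > 0\<close> M(2) by (simp_all add: e_def field_simps)
  \<comment> \<open>A segment of length below 1 that starts in \<open>cball 0 (R + 1)\<close> stays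
    in this ball.\<close>
  have "uniformly_continuous_on (cball 0 (R + 2)) (grad \<phi>)"
    by (intro compact_uniformly_continuous continuous_on_subset[OF smooth_continuous_grad[OF sm]]) auto
  then obtain d where d: "d > 0" "\<And>x y. x \<in> cball 0 (R + 2) \<Longrightarrow> y \<in> cball 0 (R + 2) \<Longrightarrow> dist y x < d
      \<Longrightarrow> dist (grad \<phi> y) (grad \<phi> x) < e"
    using e(1) unfolding uniformly_continuous_on_def by metis
  show "\<exists>\<eta>>0. \<forall>z. norm z < \<eta> \<longrightarrow>
      L2sq (\<lambda>x. \<phi> (x + z) - \<phi> x - grad \<phi> x \<bullet> z) \<le> ennreal (\<epsilon> * (norm z)\<^sup>2)"
  proof (intro exI[of _ "min d 1"] conjI allI impI)
    show "0 < min d 1" using d(1) by simp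
    fix z :: 'a assume z: "norm z < min d 1"
    have "\<bar>\<phi> (x + z) - \<phi> x - grad \<phi> x \<bullet> z\<bar> \<le> e * norm z * indicator (cball 0 (R + 1)) x" for x
    proof (cases "norm x \<le> R + 1")
      case True
      have "\<bar>\<phi> (x + z) - \<phi> x - grad \<phi> x \<bullet> z\<bar> \<le> e * norm z"
      proof (rule linearization_error_le[OF smooth_has_derivative[OF sm]])
        fix t :: real assume t: "t \<in> {0..1}"
        then have tz: "norm (t *\<^sub>R z) \<le> norm z" by (simp add: mult_left_le_one_le)
        have "norm (x + t *\<^sub>R z) \<le> norm x + norm (t *\<^sub>R z)" by (rule norm_triangle_ineq)
        then have "x + t *\<^sub>R z \<in> cball 0 (R + 2)" "x \<in> cball 0 (R + 2)"
          unfolding mem_cball_0 using True tz z by linarith+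
        moreover have "dist (x + t *\<^sub>R z) x < d"
          using tz z by (simp add: dist_norm)
        ultimately show "norm (grad \<phi> (x + t *\<^sub>R z) - grad \<phi> x) \<le> e"
          using d(2) by (metis dist_norm less_imp_le)
      qed
      then show ?thesis using True by simp
    next
      case False
      \<comment> \<open>From outside radius \<open>R + 1\<close> a step shorter than 1 cannot reach
        the support, so all three terms vanish.\<close>
      have "norm x \<le> norm (x + z) + norm z" using norm_triangle_ineq4[of "x + z" z] by simp
      then show ?thesis using False z R(2)[of "x + z"] R(2,3)[of x] by simp
    qed
    then have "L2sq (\<lambda>x. \<phi> (x + z) - \<phi> x - grad \<phi> x \<bullet> z)
        \<le> (\<integral>\<^sup>+x. ennreal ((e * norm z)\<^sup>2) * indicator (cball (0::'a) (R + 1)) x \<partial>lborel)"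
      unfolding L2sq_def
    proof (intro nn_integral_mono)
      fix x
      assume "\<And>x. \<bar>\<phi> (x + z) - \<phi> x - grad \<phi> x \<bullet> z\<bar> \<le> e * norm z * indicator (cball 0 (R + 1)) x"
      from power_mono[OF this[of x] abs_ge_zero, of 2]
      show "ennreal ((norm (\<phi> (x + z) - \<phi> x - grad \<phi> x \<bullet> z))\<^sup>2)
          \<le> ennreal ((e * norm z)\<^sup>2) * indicator (cball 0 (R + 1)) x"
        by (auto split: split_indicator intro: ennreal_leI)
    qed
    also have "\<dots> = ennreal ((e\<^sup>2 * M) * (norm z)\<^sup>2)"
      using M by (subst nn_integral_cmult_indicator)
        (auto simp: ennreal_mult'[symmetric] power_mult_distrib mult_ac)
    also have "\<dots> \<le> ennreal (\<epsilon> * (norm z)\<^sup>2)"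
      using e(2) by (intro ennreal_leI mult_right_mono) auto
    finally show "L2sq (\<lambda>x. \<phi> (x + z) - \<phi> x - grad \<phi> x \<bullet> z) \<le> ennreal (\<epsilon> * (norm z)\<^sup>2)" .
  qed
qed

text \<open>The limit is taken with \<open>z\<close> fixed: the distance of \<open>\<phi> n\<close>
  to \<open>u\<close> enters without a factor \<open>norm z\<close>, but it tends to 0, and only the
  gradient term remains. The 4 comes from two uses of the quadratic triangle inequality.\<close>

lemma L2sq_increment_le_limit:
  fixes u :: "'a::euclidean_space \<Rightarrow> real"
  assumes u [measurable]: "u \<in> borel_measurable borel" and w [measurable]: "w \<in> borel_measurable borel"
    and d\<phi>: "\<And>n x. (\<phi> n has_derivative (\<lambda>y. G n x \<bullet> y)) (at x)"
    and G: "\<And>n. continuous_on UNIV (G n)"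
    and \<phi>_lim: "(\<lambda>n. L2sq (\<lambda>x. \<phi> n x - u x)) \<longlonglongrightarrow> 0"
    and G_lim: "(\<lambda>n. L2sq (\<lambda>x. G n x - w x)) \<longlonglongrightarrow> 0"
  shows "L2sq (\<lambda>x. u (x + z) - u x) \<le> 4 * (ennreal ((norm z)\<^sup>2) * L2sq w)"
proof -
  have [measurable]: "G n \<in> borel_measurable borel" for n
    using G by (rule borel_measurable_continuous_onI)
  have [measurable]: "\<phi> n \<in> borel_measurable borel" for n
    by (intro borel_measurable_continuous_onI continuous_at_imp_continuous_on)
      (use d\<phi> has_derivative_continuous in blast)
  define Z where "Z = ennreal ((norm z)\<^sup>2)"
  have Z: "Z < top" by (simp add: Z_def)
  define h where "h n = 2 * (Z * (2 * L2sq (\<lambda>x. G n x - w x) + 2 * L2sq w)) + 8 * L2sq (\<lambda>x. \<phi> n x - u x)" for n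
  have "L2sq (\<lambda>x. u (x + z) - u x) \<le> h n" for n
  proof -
    have "L2sq (\<lambda>x. u (x + z) - u x)
        = L2sq (\<lambda>x. (\<phi> n (x + z) - \<phi> n x) - ((\<lambda>x. \<phi> n x - u x) (x + z) - (\<lambda>x. \<phi> n x - u x) x))"
      by (simp add: algebra_simps)
    also have "\<dots> \<le> 2 * L2sq (\<lambda>x. \<phi> n (x + z) - \<phi> n x)
        + 2 * L2sq (\<lambda>x. (\<lambda>x. \<phi> n x - u x) (x + z) - (\<lambda>x. \<phi> n x - u x) x)"
      by (rule L2sq_diff) measurable
    also have "\<dots> \<le> 2 * (Z * L2sq (G n)) + 2 * (4 * L2sq (\<lambda>x. \<phi> n x - u x))"
      unfolding Z_def by (intro add_mono mult_left_mono L2sq_increment_le d\<phi> G L2sq_translate_diff_le) auto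
    also have "L2sq (G n) \<le> 2 * L2sq (\<lambda>x. G n x - w x) + 2 * L2sq w"
      using L2sq_add[of "\<lambda>x. G n x - w x" w] by simp
    finally show ?thesis by (simp add: h_def mult.assoc[symmetric] mult_left_mono add_mono)
  qed
  moreover have "h \<longlonglongrightarrow> 2 * (Z * (2 * 0 + 2 * L2sq w)) + 8 * 0"
    unfolding h_def using Z
    by (intro tendsto_add ennreal_tendsto_cmult \<phi>_lim G_lim tendsto_const) auto
  ultimately have "L2sq (\<lambda>x. u (x + z) - u x) \<le> 2 * (Z * (2 * 0 + 2 * L2sq w)) + 8 * 0"
    by (intro LIMSEQ_le_const) auto
  also have "\<dots> = (2 * 2) * (Z * L2sq w)" by (simp only: mult_ac mult_zero_left mult_zero_right add_0_left add_0_right)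
  also have "(2 * 2 :: ennreal) = 4" by simp
  finally show ?thesis by (simp add: Z_def)
qed

text \<open>For \<open>\<phi> N\<close> close to \<open>u\<close> in the gradient norm, the error
  splits into the increment of \<open>u - \<phi> N\<close>, the linearization error of
  \<open>\<phi> N\<close>, and the gradient difference applied to \<open>z\<close>. The outer two
  are bounded by \<open>norm z\<close> times the gradient distance for every \<open>z\<close>; only
  the middle one restricts \<open>\<eta>\<close>.\<close>

lemma H10_L2_differentiable:
  fixes u :: "'a::euclidean_space \<Rightarrow> real"
  assumes \<Omega>: "open \<Omega>" and u: "H10 \<Omega> u" and u_zero: "\<And>x. x \<notin> \<Omega> \<Longrightarrow> u x = 0"
  obtains w where "w \<in> borel_measurable borel" "\<And>x. x \<notin> \<Omega> \<Longrightarrow> w x = 0"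
    "L2sq w < \<infinity>" "L2sq u < \<infinity>" "L2_differentiable u w"
proof -
  obtain \<phi> w0 where \<phi>: "\<And>n. test_function \<Omega> (\<phi> n)" and w0: "w0 \<in> borel_measurable lborel"
    and u_lim: "(\<lambda>n. \<integral>\<^sup>+x\<in>\<Omega>. ennreal ((\<phi> n x - u x)\<^sup>2) \<partial>lborel) \<longlonglongrightarrow> 0"
    and w_lim: "(\<lambda>n. \<integral>\<^sup>+x\<in>\<Omega>. ennreal ((norm (grad (\<phi> n) x - w0 x))\<^sup>2) \<partial>lborel) \<longlonglongrightarrow> 0"
    using u unfolding H10_def by blast
  \<comment> \<open>\<open>H10\<close> leaves the limit gradient arbitrary outside
    \<open>\<Omega>\<close>; 0 is the value that fits the zero extension.\<close>
  define w where "w x = indicator \<Omega> x *\<^sub>R w0 x" for x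
  have u_meas [measurable]: "u \<in> borel_measurable borel" using u by (simp add: H10_def)
  have w_meas [measurable]: "w \<in> borel_measurable borel"
    using w0 \<Omega> unfolding w_def[abs_def] by (auto intro!: borel_measurable_scaleR)
  have w_zero: "w x = 0" if "x \<notin> \<Omega>" for x using that by (simp add: w_def)
  have sm: "smooth (\<phi> n)" for n using \<phi>[of n] by (simp add: test_function_def)
  have grad_zero: "grad (\<phi> n) x = 0" if "x \<notin> \<Omega>" for n x
    using test_function_grad_eq_0[OF \<phi>[of n]] \<phi>[of n] that by (auto simp: test_function_def)
  have \<phi>_lim: "(\<lambda>n. L2sq (\<lambda>x. \<phi> n x - u x)) \<longlonglongrightarrow> 0"
  proof -
    have "L2sq (\<lambda>x. \<phi> n x - u x) = (\<integral>\<^sup>+x\<in>\<Omega>. ennreal ((\<phi> n x - u x)\<^sup>2) \<partial>lborel)" for n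
      unfolding L2sq_def using u_zero test_function_eq_0[OF \<phi>[of n]]
      by (intro nn_integral_cong) (auto split: split_indicator)
    then show ?thesis using u_lim by simp
  qed
  have G_lim: "(\<lambda>n. L2sq (\<lambda>x. grad (\<phi> n) x - w x)) \<longlonglongrightarrow> 0"
  proof -
    have "L2sq (\<lambda>x. grad (\<phi> n) x - w x) = (\<integral>\<^sup>+x\<in>\<Omega>. ennreal ((norm (grad (\<phi> n) x - w0 x))\<^sup>2) \<partial>lborel)" for n
      unfolding L2sq_def w_def using grad_zero[of _ n]
      by (intro nn_integral_cong) (auto split: split_indicator)
    then show ?thesis using w_lim by simp
  qed
  have grad_cont: "continuous_on UNIV (grad (\<phi> n))" for n by (rule smooth_continuous_grad[OF sm])
  have \<phi>_cont: "continuous_on UNIV (\<phi> n)" for n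
    using smooth_differentiable[OF sm] differentiable_imp_continuous_within
    by (blast intro: continuous_at_imp_continuous_on)
  have [measurable]: "grad (\<phi> n) \<in> borel_measurable borel" "\<phi> n \<in> borel_measurable borel" for n
    by (rule borel_measurable_continuous_onI grad_cont \<phi>_cont)+
  have fin: "L2sq (\<phi> n) < \<infinity>" "L2sq (grad (\<phi> n)) < \<infinity>" for n
  proof -
    obtain R where "0 < R" and R: "\<And>x. R < norm x \<Longrightarrow> \<phi> n x = 0" "\<And>x. R < norm x \<Longrightarrow> grad (\<phi> n) x = 0"
      by (rule test_function_support[OF \<phi>[of n]]) (rule that)
    show "L2sq (\<phi> n) < \<infinity>" "L2sq (grad (\<phi> n)) < \<infinity>"
      using L2sq_finite_if_compact_support[OF \<phi>_cont R(1)]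
        L2sq_finite_if_compact_support[OF grad_cont R(2)] by auto
  qed
  have u_fin: "L2sq u < \<infinity>"
  proof -
    obtain n where n: "L2sq (\<lambda>x. \<phi> n x - u x) < \<infinity>"
      using order_tendstoD(2)[OF \<phi>_lim, of \<infinity>] by (auto simp: eventually_sequentially)
    have "L2sq u \<le> 2 * L2sq (\<phi> n) + 2 * L2sq (\<lambda>x. \<phi> n x - u x)"
      using L2sq_diff[of "\<phi> n" "\<lambda>x. \<phi> n x - u x"] by simp
    also have "\<dots> < \<infinity>" using fin[of n] n by (simp add: ennreal_mult_less_top)
    finally show ?thesis .
  qed
  have w_fin: "L2sq w < \<infinity>"
  proof -
    obtain n where n: "L2sq (\<lambda>x. grad (\<phi> n) x - w x) < \<infinity>"
      using order_tendstoD(2)[OF G_lim, of \<infinity>] by (auto simp: eventually_sequentially)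
    have "L2sq w \<le> 2 * L2sq (grad (\<phi> n)) + 2 * L2sq (\<lambda>x. grad (\<phi> n) x - w x)"
      using L2sq_diff[of "grad (\<phi> n)" "\<lambda>x. grad (\<phi> n) x - w x"] by simp
    also have "\<dots> < \<infinity>" using fin[of n] n by (simp add: ennreal_mult_less_top)
    finally show ?thesis .
  qed
  have "L2_differentiable u w"
    unfolding L2_differentiable_def
  proof (intro allI impI)
    fix \<epsilon> :: real assume \<epsilon>: "\<epsilon> > 0"
    \<comment> \<open>The terms \<open>A\<close>, \<open>B\<close>, \<open>C\<close> below enter
      with factors 2, 4, 4 and bounds \<open>\<epsilon> / 6\<close>, \<open>\<epsilon> / 8\<close>,
      \<open>\<epsilon> / 24\<close> times \<open>(norm z)\<^sup>2\<close>, where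
      \<open>\<epsilon> / 6\<close> is \<open>4 * \<epsilon> / 24\<close>. The sum is exactly
      \<open>\<epsilon>\<close>.\<close>
    have "0 < ennreal (\<epsilon> / 24)" using \<epsilon> by simp
    from order_tendstoD(2)[OF G_lim this] obtain N
      where N: "L2sq (\<lambda>x. grad (\<phi> N) x - w x) < ennreal (\<epsilon> / 24)"
      by (auto simp: eventually_sequentially)
    obtain \<eta> where \<eta>: "\<eta> > 0" "\<And>z. norm z < \<eta> \<Longrightarrow>
        L2sq (\<lambda>x. \<phi> N (x + z) - \<phi> N x - grad (\<phi> N) x \<bullet> z) \<le> ennreal (\<epsilon> / 8 * (norm z)\<^sup>2)"
      using L2_differentiable_test_function[OF \<phi>[of N], unfolded L2_differentiable_def, rule_format, of "\<epsilon> / 8"] \<epsilon>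
      by auto
    have "L2sq (\<lambda>x. u (x + z) - u x - w x \<bullet> z) \<le> ennreal (\<epsilon> * (norm z)\<^sup>2)" if z: "norm z < \<eta>" for z
    proof -
      define A where "A x = (u (x + z) - \<phi> N (x + z)) - (u x - \<phi> N x)" for x
      define B where "B x = \<phi> N (x + z) - \<phi> N x - grad (\<phi> N) x \<bullet> z" for x
      define C where "C x = (grad (\<phi> N) x - w x) \<bullet> z" for x
      have [measurable]: "A \<in> borel_measurable borel" "B \<in> borel_measurable borel" "C \<in> borel_measurable borel"
        unfolding A_def[abs_def] B_def[abs_def] C_def[abs_def] by measurable
      \<comment> \<open>The increment bound is applied to the sequence
        \<open>\<phi> n - \<phi> N\<close>, which converges to \<open>u - \<phi> N\<close> together
        with its gradients.\<close>
      have "L2sq A \<le> 4 * (ennreal ((norm z)\<^sup>2) * L2sq (\<lambda>x. w x - grad (\<phi> N) x))"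
        unfolding A_def
        by (rule L2sq_increment_le_limit[where \<phi> = "\<lambda>n x. \<phi> n x - \<phi> N x"
              and G = "\<lambda>n x. grad (\<phi> n) x - grad (\<phi> N) x" and u = "\<lambda>x. u x - \<phi> N x"])
          (use \<phi>_lim G_lim in \<open>auto intro!: has_derivative_diff smooth_has_derivative[OF sm] continuous_intros grad_cont
              simp: inner_diff_left\<close>)
      also have "\<dots> \<le> 4 * (ennreal ((norm z)\<^sup>2) * ennreal (\<epsilon> / 24))"
        using N by (intro mult_left_mono) (auto simp: L2sq_minus_commute[of w])
      also have "\<dots> = ennreal (\<epsilon> / 6 * (norm z)\<^sup>2)"
        using \<epsilon> by (simp add: ennreal_mult'[symmetric] ennreal_numeral[symmetric] del: ennreal_numeral)
      finally have A: "L2sq A \<le> ennreal (\<epsilon> / 6 * (norm z)\<^sup>2)" .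
      have B: "L2sq B \<le> ennreal (\<epsilon> / 8 * (norm z)\<^sup>2)" using \<eta>(2)[OF z] by (simp add: B_def[abs_def])
      have "L2sq C \<le> ennreal ((norm z)\<^sup>2) * L2sq (\<lambda>x. grad (\<phi> N) x - w x)"
        unfolding C_def[abs_def] by (rule L2sq_inner_le) measurable
      also have "\<dots> \<le> ennreal ((norm z)\<^sup>2) * ennreal (\<epsilon> / 24)"
        using N by (intro mult_left_mono) auto
      also have "\<dots> = ennreal (\<epsilon> / 24 * (norm z)\<^sup>2)"
        using \<epsilon> by (simp add: ennreal_mult'[symmetric] mult.commute)
      finally have C: "L2sq C \<le> ennreal (\<epsilon> / 24 * (norm z)\<^sup>2)" .
      have "L2sq (\<lambda>x. u (x + z) - u x - w x \<bullet> z) = L2sq (\<lambda>x. A x + (B x + C x))"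
        by (simp add: A_def B_def C_def inner_diff_left algebra_simps)
      also have "\<dots> \<le> 2 * L2sq A + 2 * L2sq (\<lambda>x. B x + C x)"
        by (rule L2sq_add) measurable
      also have "\<dots> \<le> 2 * L2sq A + 2 * (2 * L2sq B + 2 * L2sq C)"
        by (intro add_mono mult_left_mono L2sq_add order_refl) auto
      also have "\<dots> \<le> 2 * ennreal (\<epsilon> / 6 * (norm z)\<^sup>2)
          + 2 * (2 * ennreal (\<epsilon> / 8 * (norm z)\<^sup>2) + 2 * ennreal (\<epsilon> / 24 * (norm z)\<^sup>2))"
        by (intro add_mono mult_left_mono A B C) auto
      also have "\<dots> = ennreal (\<epsilon> * (norm z)\<^sup>2)"
        using \<epsilon> by (simp add: ennreal_mult'[symmetric] ennreal_plus[symmetric] ennreal_numeral[symmetric] del: ennreal_plus ennreal_numeral)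
      finally show ?thesis .
    qed
    with \<eta>(1) show "\<exists>\<eta>>0. \<forall>z. norm z < \<eta> \<longrightarrow>
        L2sq (\<lambda>x. u (x + z) - u x - w x \<bullet> z) \<le> ennreal (\<epsilon> * (norm z)\<^sup>2)" by blast
  qed
  with w_meas w_zero w_fin u_fin show thesis by (rule that)
qed

section \<open>Identification of the weak gradient\<close>

lemma integrable_mult_if_L2:
  fixes f h :: "'a::euclidean_space \<Rightarrow> real"
  assumes [measurable]: "f \<in> borel_measurable borel" "h \<in> borel_measurable borel"
    and fin: "L2sq f < \<infinity>" "L2sq h < \<infinity>"
  shows "integrable lborel (\<lambda>x. (f x)\<^sup>2)" "integrable lborel (\<lambda>x. f x * h x)"
proof -
  have sq: "integrable lborel (\<lambda>x. (k x)\<^sup>2)" if "L2sq k < \<infinity>" "k \<in> borel_measurable borel" for k :: "'a \<Rightarrow> real"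
    using that by (intro integrableI_nonneg) (auto simp: L2sq_def)
  show "integrable lborel (\<lambda>x. (f x)\<^sup>2)" by (rule sq) (use fin in auto)
  show "integrable lborel (\<lambda>x. f x * h x)"
  proof (rule Bochner_Integration.integrable_bound)
    show "integrable lborel (\<lambda>x. (f x)\<^sup>2 + (h x)\<^sup>2)"
      by (intro Bochner_Integration.integrable_add sq) (use fin in auto)
    show "AE x in lborel. norm (f x * h x) \<le> norm ((f x)\<^sup>2 + (h x)\<^sup>2)"
    proof (rule AE_I2)
      fix x
      have "2 * (\<bar>f x\<bar> * \<bar>h x\<bar>) \<le> (f x)\<^sup>2 + (h x)\<^sup>2"
        using sum_squares_bound[of "\<bar>f x\<bar>" "\<bar>h x\<bar>"] by (simp add: mult.assoc)
      moreover have "0 \<le> \<bar>f x\<bar> * \<bar>h x\<bar>" by simp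
      ultimately show "norm (f x * h x) \<le> norm ((f x)\<^sup>2 + (h x)\<^sup>2)"
        unfolding real_norm_def abs_mult by linarith
    qed
  qed measurable
qed

text \<open>Young's inequality with a free weight \<open>s\<close>, in place of Cauchy-Schwarz:
  balancing the two terms is left to the choice of \<open>s\<close>.\<close>

lemma integral_mult_le:
  fixes f h :: "'a::euclidean_space \<Rightarrow> real"
  assumes [measurable]: "f \<in> borel_measurable borel" "h \<in> borel_measurable borel"
    and A: "L2sq f \<le> ennreal A" "0 \<le> A" and B: "L2sq h \<le> ennreal B" "0 \<le> B" and s: "s > 0"
  shows "\<bar>LINT x|lborel. f x * h x\<bar> \<le> (s * A + B / s) / 2"
proof -
  have fin: "L2sq f < \<infinity>" "L2sq h < \<infinity>"
    using A B by (auto intro: le_less_trans)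
  note I = integrable_mult_if_L2[OF assms(1,2) fin] integrable_mult_if_L2(1)[OF assms(2,1) fin(2,1)]
  have le: "(LINT x|lborel. (k x)\<^sup>2) \<le> K" if "L2sq k \<le> ennreal K" "0 \<le> K" "integrable lborel (\<lambda>x. (k x)\<^sup>2)"
    for k :: "'a \<Rightarrow> real" and K
    using that nn_integral_eq_integral[OF that(3)] by (simp add: L2sq_def)
  have "\<bar>LINT x|lborel. f x * h x\<bar> \<le> (LINT x|lborel. \<bar>f x * h x\<bar>)"
    by (rule integral_abs_bound)
  also have "\<dots> \<le> (LINT x|lborel. (s / 2) * (f x)\<^sup>2 + (1 / (2 * s)) * (h x)\<^sup>2)"
  proof (rule integral_mono)
    fix x
    have "0 \<le> (s * \<bar>f x\<bar> - \<bar>h x\<bar>)\<^sup>2" by simp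
    then have "2 * s * \<bar>f x * h x\<bar> \<le> s\<^sup>2 * (f x)\<^sup>2 + (h x)\<^sup>2"
      by (simp add: power2_diff power_mult_distrib abs_mult mult_ac)
    then show "\<bar>f x * h x\<bar> \<le> (s / 2) * (f x)\<^sup>2 + (1 / (2 * s)) * (h x)\<^sup>2"
      using s by (simp add: field_simps power2_eq_square)
  qed (use I in auto)
  also have "\<dots> = (s / 2) * (LINT x|lborel. (f x)\<^sup>2) + (1 / (2 * s)) * (LINT x|lborel. (h x)\<^sup>2)"
    using I by simp
  also have "\<dots> \<le> (s / 2) * A + (1 / (2 * s)) * B"
    using s by (intro add_mono mult_left_mono le I A B) auto
  finally show ?thesis using s by (simp add: field_simps)
qed

lemma integral_lborel_translate:
  fixes f :: "'a::euclidean_space \<Rightarrow> real"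
  assumes [measurable]: "f \<in> borel_measurable borel"
  shows "(LINT x|lborel. f (x + z)) = (LINT x|lborel. f x)"
  using integral_distr[of "(+) z" lborel borel f] by (simp add: lborel_distr_plus add.commute[of z])

text \<open>By translation invariance, pairing \<open>u (x + z)\<close> with \<open>v x\<close>
  equals pairing \<open>u x\<close> with \<open>v (x - z)\<close>. Linearizing both sides at
  \<open>z = t *\<^sub>R i\<close> gives \<open>t * c\<close> up to an error \<open>o(t)\<close>,
  where \<open>c\<close> is the defect of the claimed identity; hence \<open>c = 0\<close>.\<close>

lemma L2_differentiable_integral_by_parts:
  fixes u v :: "'a::euclidean_space \<Rightarrow> real"
  assumes [measurable]: "u \<in> borel_measurable borel" "v \<in> borel_measurable borel"
      "wu \<in> borel_measurable borel" "wv \<in> borel_measurable borel"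
    and fin: "L2sq u < \<infinity>" "L2sq v < \<infinity>" "L2sq wu < \<infinity>" "L2sq wv < \<infinity>"
    and du: "L2_differentiable u wu" and dv: "L2_differentiable v wv" and i: "norm i = 1"
  shows "(LINT x|lborel. u x * (wv x \<bullet> i)) = - (LINT x|lborel. (wu x \<bullet> i) * v x)"
proof -
  define c where "c = (LINT x|lborel. u x * (wv x \<bullet> i)) + (LINT x|lborel. (wu x \<bullet> i) * v x)"
  \<comment> \<open>The maximum with 1 keeps \<open>K\<close> positive, since it becomes a
    denominator.\<close>
  define K where "K = max 1 (max (enn2real (L2sq u)) (enn2real (L2sq v)))"
  have K: "L2sq u \<le> ennreal K" "L2sq v \<le> ennreal K" "K > 0"
  proof -
    have "ennreal (enn2real (L2sq u)) \<le> ennreal K" "ennreal (enn2real (L2sq v)) \<le> ennreal K"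
      by (intro ennreal_leI; simp add: K_def)+
    then show "L2sq u \<le> ennreal K" "L2sq v \<le> ennreal K" "K > 0"
      using fin(1,2) by (auto simp: K_def)
  qed
  have L2_i: "L2sq (\<lambda>x. f x \<bullet> i) < \<infinity>" if "L2sq f < \<infinity>" "f \<in> borel_measurable borel" for f :: "'a \<Rightarrow> 'a"
    using L2sq_inner_le[OF that(2), of i] that(1) by (simp add: i)
  have c_le: "\<bar>c\<bar> \<le> 2 * e" if e: "e > 0" for e
  proof -
    define \<epsilon> where "\<epsilon> = e\<^sup>2 / K"
    have \<epsilon>: "\<epsilon> > 0" using e K by (simp add: \<epsilon>_def)
    obtain \<eta>1 where \<eta>1: "\<eta>1 > 0" "\<And>z. norm z < \<eta>1 \<Longrightarrow>
        L2sq (\<lambda>x. u (x + z) - u x - wu x \<bullet> z) \<le> ennreal (\<epsilon> * (norm z)\<^sup>2)"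
      using du[unfolded L2_differentiable_def, rule_format, OF \<epsilon>] by auto
    obtain \<eta>2 where \<eta>2: "\<eta>2 > 0" "\<And>z. norm z < \<eta>2 \<Longrightarrow>
        L2sq (\<lambda>x. v (x + z) - v x - wv x \<bullet> z) \<le> ennreal (\<epsilon> * (norm z)\<^sup>2)"
      using dv[unfolded L2_differentiable_def, rule_format, OF \<epsilon>] by auto
    define t where "t = min \<eta>1 \<eta>2 / 2"
    have t: "t > 0" "t < \<eta>1" "t < \<eta>2" using \<eta>1(1) \<eta>2(1) by (auto simp: t_def)
    define z where "z = t *\<^sub>R i"
    have nz: "norm z = t" using t i by (simp add: z_def)
    define a where "a x = u (x + z) - u x - wu x \<bullet> z" for x
    define b where "b x = v (x + - z) - v x - wv x \<bullet> (- z)" for x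
    have [measurable]: "a \<in> borel_measurable borel" "b \<in> borel_measurable borel"
      unfolding a_def[abs_def] b_def[abs_def] by measurable
    have a: "L2sq a \<le> ennreal (\<epsilon> * t\<^sup>2)" using \<eta>1(2)[of z] t nz by (simp add: a_def[abs_def])
    have b: "L2sq b \<le> ennreal (\<epsilon> * t\<^sup>2)" using \<eta>2(2)[of "- z"] t nz by (simp add: b_def[abs_def])
    have ab_fin: "L2sq a < \<infinity>" "L2sq b < \<infinity>" using a b by (auto intro: le_less_trans)
    \<comment> \<open>With \<open>\<epsilon> = e\<^sup>2 / K\<close> this weight balances Young's
      bound: each half is \<open>t * e / 2\<close>.\<close>
    define s where "s = K / e / t"
    have s: "s > 0" using K e t by (simp add: s_def)
    have est: "(s * (\<epsilon> * t\<^sup>2) + K / s) / 2 = t * e"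
      using K e t by (simp add: s_def \<epsilon>_def power2_eq_square)
    have av: "\<bar>LINT x|lborel. a x * v x\<bar> \<le> t * e"
      using integral_mult_le[of a v, OF _ _ a _ K(2) _ s] \<epsilon> K est by simp
    have bu: "\<bar>LINT x|lborel. b x * u x\<bar> \<le> t * e"
      using integral_mult_le[of b u, OF _ _ b _ K(1) _ s] \<epsilon> K est by simp
    have tr: "L2sq (\<lambda>x. u (x + z)) < \<infinity>" "L2sq (\<lambda>x. v (x + - z)) < \<infinity>"
      using fin L2sq_translate[of u z] L2sq_translate[of v "- z"] by simp_all
    have I: "integrable lborel (\<lambda>x. u (x + z) * v x)" "integrable lborel (\<lambda>x. u x * v x)"
      "integrable lborel (\<lambda>x. (wu x \<bullet> i) * v x)" "integrable lborel (\<lambda>x. v (x + - z) * u x)"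
      "integrable lborel (\<lambda>x. (wv x \<bullet> i) * u x)"
      by (intro integrable_mult_if_L2 tr fin L2_i; measurable)+
    have "(LINT x|lborel. a x * v x) = (LINT x|lborel. u (x + z) * v x - u x * v x - t * ((wu x \<bullet> i) * v x))"
      by (simp add: a_def z_def algebra_simps)
    also have "\<dots> = (LINT x|lborel. u (x + z) * v x) - (LINT x|lborel. u x * v x) - t * (LINT x|lborel. (wu x \<bullet> i) * v x)"
      using I by simp
    finally have 1: "(LINT x|lborel. a x * v x) = \<dots>" .
    have "(LINT x|lborel. b x * u x) = (LINT x|lborel. v (x + - z) * u x - u x * v x + t * ((wv x \<bullet> i) * u x))"
      by (simp add: b_def z_def algebra_simps)
    also have "\<dots> = (LINT x|lborel. v (x + - z) * u x) - (LINT x|lborel. u x * v x) + t * (LINT x|lborel. (wv x \<bullet> i) * u x)"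
      using I by simp
    finally have 2: "(LINT x|lborel. b x * u x) = \<dots>" .
    have "(LINT x|lborel. u (x + z) * v x) = (LINT x|lborel. v (x + - z) * u x)"
      using integral_lborel_translate[of "\<lambda>x. v (x + - z) * u x" z] by (simp add: mult.commute)
    with 1 2 have "t * c = (LINT x|lborel. b x * u x) - (LINT x|lborel. a x * v x)"
      by (simp add: c_def algebra_simps)
    with av bu have "\<bar>t * c\<bar> \<le> t * (2 * e)" by simp
    then show ?thesis using t by (simp add: abs_mult)
  qed
  have "\<bar>c\<bar> \<le> 0"
  proof (rule field_le_epsilon)
    fix e :: real assume "0 < e"
    then show "\<bar>c\<bar> \<le> 0 + e" using c_le[of "e / 2"] by simp
  qed
  then have "c = 0" by simp
  then show ?thesis by (simp add: c_def)
qed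

lemma weak_gradient_AE_eq:
  fixes u :: "'a::euclidean_space \<Rightarrow> real"
  assumes D: "open D" and u: "H1_weak_grad D u g"
    and u_zero: "\<And>x. x \<notin> D \<Longrightarrow> u x = 0" and w_zero: "\<And>x. x \<notin> D \<Longrightarrow> w x = 0"
    and w [measurable]: "w \<in> borel_measurable borel"
    and fin: "L2sq u < \<infinity>" "L2sq w < \<infinity>" and du: "L2_differentiable u w"
  shows "AE x in lborel. x \<in> D \<longrightarrow> g x = w x"
proof -
  have [measurable]: "u \<in> borel_measurable borel" "g \<in> borel_measurable borel" "D \<in> sets borel"
    using u D by (auto simp: H1_weak_grad_def)
  \<comment> \<open>The weak gradient is controlled only on \<open>D\<close>; the cut-off makes it
    square integrable on the whole space.\<close>
  define g' where "g' x = indicator D x *\<^sub>R g x" for x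
  have [measurable]: "g' \<in> borel_measurable borel" unfolding g'_def[abs_def] by measurable
  have g'_fin: "L2sq g' < \<infinity>"
  proof -
    have "L2sq g' = (\<integral>\<^sup>+x\<in>D. ennreal ((norm (g x))\<^sup>2) \<partial>lborel)"
      unfolding L2sq_def g'_def by (intro nn_integral_cong) (auto split: split_indicator)
    then show ?thesis using u by (simp add: H1_weak_grad_def)
  qed
  have L2_i: "L2sq (\<lambda>x. f x \<bullet> i) < \<infinity>"
    if "L2sq f < \<infinity>" "f \<in> borel_measurable borel" for f :: "'a \<Rightarrow> 'a" and i
    using L2sq_inner_le[OF that(2), of i] that(1)
    by (auto intro: le_less_trans simp: ennreal_mult_less_top)
  have "AE x in lborel. x \<in> D \<longrightarrow> (g' x - w x) \<bullet> i = 0" if i: "i \<in> Basis" for i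
  proof (rule AE_zero_if_orthogonal_to_test_functions[OF D])
    have diff_fin: "L2sq (\<lambda>x. (g' x - w x) \<bullet> i) < \<infinity>"
    proof (rule L2_i)
      have "L2sq (\<lambda>x. g' x - w x) \<le> 2 * L2sq g' + 2 * L2sq w" by (rule L2sq_diff) measurable
      also have "\<dots> < \<infinity>" using g'_fin fin by (simp add: ennreal_mult_less_top)
      finally show "L2sq (\<lambda>x. g' x - w x) < \<infinity>" .
    qed measurable
    show "set_integrable lborel (cbox a b) (\<lambda>x. (g' x - w x) \<bullet> i)" for a b
    proof -
      have "L2sq (indicator (cbox a b) :: 'a \<Rightarrow> real) = (\<integral>\<^sup>+x. indicator (cbox a b) x \<partial>(lborel :: 'a measure))"
        unfolding L2sq_def by (intro nn_integral_cong) (auto split: split_indicator)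
      also have "\<dots> < \<infinity>" using emeasure_bounded_finite[of "cbox a b"] by simp
      finally show ?thesis
        unfolding set_integrable_def real_scaleR_def
        by (intro integrable_mult_if_L2 diff_fin) measurable
    qed
    fix \<psi> assume \<psi>: "test_function D \<psi>"
    then have sm: "smooth \<psi>" by (simp add: test_function_def)
    have cont: "continuous_on UNIV (grad \<psi>)" by (rule smooth_continuous_grad[OF sm])
    have \<psi>_cont: "continuous_on UNIV \<psi>"
      using smooth_differentiable[OF sm] differentiable_imp_continuous_within
      by (blast intro: continuous_at_imp_continuous_on)
    have [measurable]: "grad \<psi> \<in> borel_measurable borel" "\<psi> \<in> borel_measurable borel"
      by (rule borel_measurable_continuous_onI cont \<psi>_cont)+
    obtain R where "0 < R" and R: "\<And>x. R < norm x \<Longrightarrow> \<psi> x = 0" "\<And>x. R < norm x \<Longrightarrow> grad \<psi> x = 0"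
      by (rule test_function_support[OF \<psi>]) (rule that)
    have \<psi>_fin: "L2sq \<psi> < \<infinity>" "L2sq (grad \<psi>) < \<infinity>"
      using L2sq_finite_if_compact_support[OF \<psi>_cont R(1)]
        L2sq_finite_if_compact_support[OF cont R(2)] by auto
    have "(LINT x|lborel. u x * (grad \<psi> x \<bullet> i)) = - (LINT x|lborel. (w x \<bullet> i) * \<psi> x)"
      by (rule L2_differentiable_integral_by_parts)
        (use fin \<psi>_fin du L2_differentiable_test_function[OF \<psi>] i in auto)
    moreover have "(LINT x|lborel. u x * (grad \<psi> x \<bullet> i)) = (LINT x:D|lborel. u x * partial i \<psi> x)"
      unfolding set_lebesgue_integral_def using u_zero
      by (intro Bochner_Integration.integral_cong) (auto simp: grad_inner_Basis[OF i] split: split_indicator)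
    moreover have "(LINT x:D|lborel. u x * partial i \<psi> x) = - (LINT x:D|lborel. (g x \<bullet> i) * \<psi> x)"
      using u \<psi> i by (simp add: H1_weak_grad_def)
    moreover have "(LINT x:D|lborel. (g x \<bullet> i) * \<psi> x) = (LINT x|lborel. (g' x \<bullet> i) * \<psi> x)"
      unfolding set_lebesgue_integral_def g'_def
      by (intro Bochner_Integration.integral_cong) (auto split: split_indicator)
    moreover have "(LINT x:D|lborel. ((g' x - w x) \<bullet> i) * \<psi> x)
        = (LINT x|lborel. (g' x \<bullet> i) * \<psi> x - (w x \<bullet> i) * \<psi> x)"
      unfolding set_lebesgue_integral_def using w_zero
      by (intro Bochner_Integration.integral_cong)
        (auto simp: g'_def inner_diff_left left_diff_distrib split: split_indicator)
    moreover have "integrable lborel (\<lambda>x. (g' x \<bullet> i) * \<psi> x)" "integrable lborel (\<lambda>x. (w x \<bullet> i) * \<psi> x)"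
      by (intro integrable_mult_if_L2 L2_i g'_fin fin \<psi>_fin; measurable)+
    ultimately show "(LINT x:D|lborel. ((g' x - w x) \<bullet> i) * \<psi> x) = 0" by simp
  qed measurable
  then have "AE x in lborel. \<forall>i\<in>Basis. x \<in> D \<longrightarrow> (g' x - w x) \<bullet> i = 0"
    by (rule AE_finite_allI[OF finite_Basis])
  then show ?thesis
  proof eventually_elim
    case (elim x)
    show ?case
    proof
      assume "x \<in> D"
      with elim have "g' x - w x = 0" by (simp add: euclidean_eq_iff[of _ "0::'a"])
      with \<open>x \<in> D\<close> show "g x = w x" by (simp add: g'_def)
    qed
  qed
qed

section \<open>Second moments of radial kernels\<close>

lemma integral_lborel_reflect:
  fixes f :: "'a::euclidean_space \<Rightarrow> real"
  assumes i: "i \<in> Basis" and [measurable]: "f \<in> borel_measurable borel"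
  shows "(LINT x|lborel. f (x - (2 * (x \<bullet> i)) *\<^sub>R i)) = (LINT x|lborel. f x)"
proof -
  define c where "c j = (if j = i then - 1 else 1 :: real)" for j
  have "(0::'a) + (\<Sum>j\<in>Basis. (c j * (x \<bullet> j)) *\<^sub>R j) = x - (2 * (x \<bullet> i)) *\<^sub>R i" for x :: 'a
    by (rule euclidean_eqI) (use i in \<open>auto simp: inner_diff_left inner_Basis c_def\<close>)
  moreover have "(\<Prod>j\<in>(Basis :: 'a set). \<bar>c j\<bar>) = 1"
    by (intro prod.neutral) (auto simp: c_def)
  ultimately have "distr lborel borel (\<lambda>x. x - (2 * (x \<bullet> i)) *\<^sub>R i) = lborel"
    using lborel_affine_euclidean[of c 0] by (simp add: c_def density_1)
  then show ?thesis
    using integral_distr[of "\<lambda>x. x - (2 * (x \<bullet> i)) *\<^sub>R i" lborel borel f] by simp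
qed

lemma norm_reflect:
  fixes x :: "'a::euclidean_space"
  assumes "i \<in> Basis"
  shows "norm (x - (2 * (x \<bullet> i)) *\<^sub>R i) = norm x"
  using assms inner_commute[of i x] by (simp add: norm_eq_sqrt_inner inner_diff_left inner_diff_right)

text \<open>Expand the square into coordinates. Mixed terms are integrable because the diagonal ones
  dominate them, and reflecting one coordinate flips their sign while keeping the norm. The moments
  \<open>m i\<close> stay general to serve both the full kernel, with moments 1, and the truncated
  one, with moments only close to 1.\<close>

lemma radial_second_moment:
  fixes \<kappa> :: "real \<Rightarrow> real" and a :: "'a::euclidean_space"
  assumes [measurable]: "\<kappa> \<in> borel_measurable borel" and \<kappa>: "\<And>t. 0 \<le> \<kappa> t"
    and m: "\<And>i. i \<in> Basis \<Longrightarrow> (\<integral>\<^sup>+z. ennreal ((z \<bullet> i)\<^sup>2 * \<kappa> (norm z)) \<partial>(lborel :: 'a measure)) = ennreal (m i)"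
      "\<And>i. i \<in> Basis \<Longrightarrow> 0 \<le> m i"
  shows "(\<integral>\<^sup>+z. ennreal ((a \<bullet> z)\<^sup>2 * \<kappa> (norm z)) \<partial>lborel) = ennreal (\<Sum>i\<in>Basis. (a \<bullet> i)\<^sup>2 * m i)"
proof -
  define F where "F i j z = (z \<bullet> i) * (z \<bullet> j) * \<kappa> (norm z)" for i j z :: 'a
  have [measurable]: "F i j \<in> borel_measurable borel" for i j unfolding F_def[abs_def] by measurable
  have diag: "has_bochner_integral lborel (F i i) (m i)" if "i \<in> Basis" for i
    using m[OF that] \<kappa> unfolding F_def[abs_def] power2_eq_square
    by (intro has_bochner_integral_nn_integral) auto
  have int: "integrable lborel (F i j)" if ij: "i \<in> Basis" "j \<in> Basis" for i j
  proof (rule Bochner_Integration.integrable_bound)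
    show "integrable lborel (\<lambda>z. F i i z + F j j z)"
      using diag ij by (intro Bochner_Integration.integrable_add) (auto simp: has_bochner_integral_iff)
    show "AE z in lborel. norm (F i j z) \<le> norm (F i i z + F j j z)"
    proof (rule AE_I2)
      fix z
      have "2 * (\<bar>z \<bullet> i\<bar> * \<bar>z \<bullet> j\<bar>) \<le> (z \<bullet> i)\<^sup>2 + (z \<bullet> j)\<^sup>2"
        using sum_squares_bound[of "\<bar>z \<bullet> i\<bar>" "\<bar>z \<bullet> j\<bar>"] by (simp add: mult.assoc)
      moreover have "0 \<le> \<bar>z \<bullet> i\<bar> * \<bar>z \<bullet> j\<bar>" by simp
      ultimately have "\<bar>z \<bullet> i\<bar> * \<bar>z \<bullet> j\<bar> \<le> (z \<bullet> i)\<^sup>2 + (z \<bullet> j)\<^sup>2" by linarith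
      from mult_right_mono[OF this \<kappa>[of "norm z"]]
      show "norm (F i j z) \<le> norm (F i i z + F j j z)"
        using \<kappa>[of "norm z"] by (simp add: F_def abs_mult power2_eq_square distrib_right)
    qed
  qed measurable
  have off: "(LINT z|lborel. F i j z) = 0" if ij: "i \<in> Basis" "j \<in> Basis" "i \<noteq> j" for i j
  proof -
    have "(LINT z|lborel. F i j z) = (LINT z|lborel. F i j (z - (2 * (z \<bullet> i)) *\<^sub>R i))"
      by (rule integral_lborel_reflect[symmetric]) (use ij in auto)
    also have "\<dots> = (LINT z|lborel. - F i j z)"
      using ij by (intro Bochner_Integration.integral_cong)
        (auto simp: F_def norm_reflect inner_diff_left inner_Basis)
    finally show ?thesis by simp
  qed
  have sq: "(a \<bullet> z)\<^sup>2 = (\<Sum>i\<in>Basis. \<Sum>j\<in>Basis. (a \<bullet> i) * (z \<bullet> i) * ((a \<bullet> j) * (z \<bullet> j)))" for z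
    unfolding euclidean_inner[of a z] power2_eq_square sum_product ..
  have expand: "(a \<bullet> z)\<^sup>2 * \<kappa> (norm z) = (\<Sum>i\<in>Basis. \<Sum>j\<in>Basis. (a \<bullet> i) * (a \<bullet> j) * F i j z)" for z
    unfolding sq sum_distrib_right F_def
    by (intro sum.cong refl) (simp add: mult_ac)
  have "integrable lborel (\<lambda>z. (a \<bullet> z)\<^sup>2 * \<kappa> (norm z))"
    unfolding expand using int by auto
  then have "(\<integral>\<^sup>+z. ennreal ((a \<bullet> z)\<^sup>2 * \<kappa> (norm z)) \<partial>lborel) = ennreal (LINT z|lborel. (a \<bullet> z)\<^sup>2 * \<kappa> (norm z))"
    using \<kappa> by (intro nn_integral_eq_integral) auto
  also have "(LINT z|lborel. (a \<bullet> z)\<^sup>2 * \<kappa> (norm z))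
      = (\<Sum>i\<in>Basis. \<Sum>j\<in>Basis. (a \<bullet> i) * (a \<bullet> j) * (LINT z|lborel. F i j z))"
    unfolding expand using int by (simp add: Bochner_Integration.integral_sum)
  also have "\<dots> = (\<Sum>i\<in>Basis. \<Sum>j\<in>Basis. if j = i then (a \<bullet> i)\<^sup>2 * m i else 0)"
    using off diag by (intro sum.cong refl) (auto simp: has_bochner_integral_iff power2_eq_square)
  also have "\<dots> = (\<Sum>i\<in>Basis. (a \<bullet> i)\<^sup>2 * m i)" by simp
  finally show ?thesis .
qed

section \<open>Convergence of the nonlocal energies\<close>

text \<open>The gap is \<open>(\<tau> * b - (a - b))\<^sup>2 / \<tau>\<close>. The leading factor is
  close to 1 for small \<open>\<tau>\<close>, at the price of a large factor on the error.\<close>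

lemma power2_le_perturbed:
  fixes a b :: real
  assumes "\<tau> > 0"
  shows "a\<^sup>2 \<le> (1 + \<tau>) * b\<^sup>2 + (1 + 1 / \<tau>) * (a - b)\<^sup>2"
proof -
  have "0 \<le> (\<tau> * b - (a - b))\<^sup>2 / \<tau>" using assms by simp
  also have "\<dots> = (1 + \<tau>) * b\<^sup>2 + (1 + 1 / \<tau>) * (a - b)\<^sup>2 - a\<^sup>2"
    using assms by (simp add: field_simps power2_eq_square)
  finally show ?thesis by simp
qed

text \<open>Stated for arbitrary \<open>F\<close> and \<open>H\<close>, so that increment and
  linearization can take either role. The restriction to \<open>S\<close> is kept in the main terms
  and given up in the error, which is estimated on the whole space.\<close>

lemma energy_le_perturbed:
  fixes F H :: "'a::euclidean_space \<Rightarrow> 'a \<Rightarrow> real"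
  assumes [measurable]: "(\<lambda>(x, z). F x z) \<in> borel_measurable (borel \<Otimes>\<^sub>M borel)"
      "(\<lambda>(x, z). H x z) \<in> borel_measurable (borel \<Otimes>\<^sub>M borel)"
      "\<kappa> \<in> borel_measurable borel" "S \<in> sets borel"
    and \<kappa>: "\<And>t. 0 \<le> \<kappa> t" and \<tau>: "\<tau> > 0"
  shows "(\<integral>\<^sup>+x\<in>S. (\<integral>\<^sup>+z. ennreal ((F x z)\<^sup>2 * \<kappa> (norm z)) \<partial>lborel) \<partial>lborel)
    \<le> ennreal (1 + \<tau>) * (\<integral>\<^sup>+x\<in>S. (\<integral>\<^sup>+z. ennreal ((H x z)\<^sup>2 * \<kappa> (norm z)) \<partial>lborel) \<partial>lborel)
      + ennreal (1 + 1 / \<tau>) * (\<integral>\<^sup>+x. (\<integral>\<^sup>+z. ennreal ((F x z - H x z)\<^sup>2 * \<kappa> (norm z)) \<partial>lborel) \<partial>lborel)"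
proof -
  have pt: "ennreal ((F x z)\<^sup>2 * \<kappa> (norm z)) \<le> ennreal (1 + \<tau>) * ennreal ((H x z)\<^sup>2 * \<kappa> (norm z))
      + ennreal (1 + 1 / \<tau>) * ennreal ((F x z - H x z)\<^sup>2 * \<kappa> (norm z))" for x z
  proof -
    have "(F x z)\<^sup>2 * \<kappa> (norm z) \<le> ((1 + \<tau>) * (H x z)\<^sup>2 + (1 + 1 / \<tau>) * (F x z - H x z)\<^sup>2) * \<kappa> (norm z)"
      by (intro mult_right_mono power2_le_perturbed \<tau> \<kappa>)
    also have "\<dots> = (1 + \<tau>) * ((H x z)\<^sup>2 * \<kappa> (norm z)) + (1 + 1 / \<tau>) * ((F x z - H x z)\<^sup>2 * \<kappa> (norm z))"
      by (simp only: distrib_right mult.assoc)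
    finally have "ennreal ((F x z)\<^sup>2 * \<kappa> (norm z)) \<le>
        ennreal ((1 + \<tau>) * ((H x z)\<^sup>2 * \<kappa> (norm z)) + (1 + 1 / \<tau>) * ((F x z - H x z)\<^sup>2 * \<kappa> (norm z)))"
      by (rule ennreal_leI)
    also have "\<dots> = ennreal (1 + \<tau>) * ennreal ((H x z)\<^sup>2 * \<kappa> (norm z))
      + ennreal (1 + 1 / \<tau>) * ennreal ((F x z - H x z)\<^sup>2 * \<kappa> (norm z))"
      using \<tau> \<kappa>[of "norm z"] by (subst ennreal_plus) (auto simp del: ennreal_plus simp: ennreal_mult')
    finally show ?thesis .
  qed
  let ?I = "\<lambda>G x. \<integral>\<^sup>+z. ennreal ((G x z)\<^sup>2 * \<kappa> (norm z)) \<partial>lborel"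
  have "?I F x \<le> ennreal (1 + \<tau>) * ?I H x + ennreal (1 + 1 / \<tau>) * ?I (\<lambda>x z. F x z - H x z) x" for x
  proof -
    have "?I F x \<le> (\<integral>\<^sup>+z. ennreal (1 + \<tau>) * ennreal ((H x z)\<^sup>2 * \<kappa> (norm z))
      + ennreal (1 + 1 / \<tau>) * ennreal ((F x z - H x z)\<^sup>2 * \<kappa> (norm z)) \<partial>lborel)"
      by (intro nn_integral_mono pt)
    also have "\<dots> = ennreal (1 + \<tau>) * ?I H x + ennreal (1 + 1 / \<tau>) * ?I (\<lambda>x z. F x z - H x z) x"
      by (subst nn_integral_add) (simp_all add: nn_integral_cmult)
    finally show ?thesis .
  qed
  then have "(\<integral>\<^sup>+x\<in>S. ?I F x \<partial>lborel) \<le> (\<integral>\<^sup>+x. ennreal (1 + \<tau>) * (?I H x * indicator S x)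
      + ennreal (1 + 1 / \<tau>) * ?I (\<lambda>x z. F x z - H x z) x \<partial>lborel)"
    by (intro nn_integral_mono) (auto split: split_indicator)
  also have "\<dots> = ennreal (1 + \<tau>) * (\<integral>\<^sup>+x\<in>S. ?I H x \<partial>lborel)
      + ennreal (1 + 1 / \<tau>) * (\<integral>\<^sup>+x. ?I (\<lambda>x z. F x z - H x z) x \<partial>lborel)"
    by (subst nn_integral_add) (simp_all add: nn_integral_cmult)
  finally show ?thesis .
qed

text \<open>Tonelli isolates the mean square error at fixed \<open>z\<close>, and
  \<open>\<kappa>\<close> vanishes where no bound on that error is available. Since
  \<open>(norm z)\<^sup>2\<close> is the sum of the squared coordinates, each with moment at most 1,
  the dimension appears.\<close>

lemma linearization_energy_le:
  fixes u :: "'a::euclidean_space \<Rightarrow> real"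
  assumes [measurable]: "u \<in> borel_measurable borel" "w \<in> borel_measurable borel" "\<kappa> \<in> borel_measurable borel"
    and \<kappa>: "\<And>t. 0 \<le> \<kappa> t" and \<kappa>_zero: "\<And>t. \<eta> \<le> t \<Longrightarrow> \<kappa> t = 0"
    and \<epsilon>: "\<epsilon> \<ge> 0" and err: "\<And>z. norm z < \<eta> \<Longrightarrow> L2sq (\<lambda>x. u (x + z) - u x - w x \<bullet> z) \<le> ennreal (\<epsilon> * (norm z)\<^sup>2)"
    and m: "\<And>i. i \<in> Basis \<Longrightarrow> (\<integral>\<^sup>+z. ennreal ((z \<bullet> i)\<^sup>2 * \<kappa> (norm z)) \<partial>(lborel :: 'a measure)) \<le> 1"
  shows "(\<integral>\<^sup>+x. (\<integral>\<^sup>+z. ennreal ((u (x + z) - u x - w x \<bullet> z)\<^sup>2 * \<kappa> (norm z)) \<partial>lborel) \<partial>lborel)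
    \<le> ennreal (\<epsilon> * DIM('a))"
proof -
  have "(\<integral>\<^sup>+x. (\<integral>\<^sup>+z. ennreal ((u (x + z) - u x - w x \<bullet> z)\<^sup>2 * \<kappa> (norm z)) \<partial>lborel) \<partial>lborel)
      = (\<integral>\<^sup>+z. (\<integral>\<^sup>+x. ennreal ((u (x + z) - u x - w x \<bullet> z)\<^sup>2 * \<kappa> (norm z)) \<partial>lborel) \<partial>lborel)"
    by (rule lborel_pair.Fubini') measurable
  also have "\<dots> = (\<integral>\<^sup>+z. L2sq (\<lambda>x. u (x + z) - u x - w x \<bullet> z) * ennreal (\<kappa> (norm z)) \<partial>lborel)"
    using \<kappa> by (intro nn_integral_cong) (simp add: L2sq_def ennreal_mult nn_integral_multc)
  also have "\<dots> \<le> (\<integral>\<^sup>+z. ennreal \<epsilon> * (\<Sum>i\<in>Basis. ennreal ((z \<bullet> i)\<^sup>2 * \<kappa> (norm z))) \<partial>(lborel :: 'a measure))"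
  proof (rule nn_integral_mono)
    fix z :: 'a
    have "(norm z)\<^sup>2 = (\<Sum>i\<in>Basis. (z \<bullet> i)\<^sup>2)"
      unfolding power2_norm_eq_inner by (subst euclidean_inner) (simp add: power2_eq_square)
    then have eq: "ennreal \<epsilon> * (\<Sum>i\<in>Basis. ennreal ((z \<bullet> i)\<^sup>2 * \<kappa> (norm z))) = ennreal (\<epsilon> * (norm z)\<^sup>2) * ennreal (\<kappa> (norm z))"
      using \<epsilon> \<kappa>[of "norm z"]
      by (simp add: sum_ennreal ennreal_mult'[symmetric] ennreal_mult''[symmetric] sum_distrib_right[symmetric] mult.assoc)
    show "L2sq (\<lambda>x. u (x + z) - u x - w x \<bullet> z) * ennreal (\<kappa> (norm z))
        \<le> ennreal \<epsilon> * (\<Sum>i\<in>Basis. ennreal ((z \<bullet> i)\<^sup>2 * \<kappa> (norm z)))"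
      unfolding eq using err[of z] \<kappa>_zero[of "norm z"]
      by (cases "norm z < \<eta>") (auto intro: mult_right_mono)
  qed
  also have "\<dots> = ennreal \<epsilon> * (\<Sum>i\<in>Basis. \<integral>\<^sup>+z. ennreal ((z \<bullet> i)\<^sup>2 * \<kappa> (norm z)) \<partial>(lborel :: 'a measure))"
    by (simp add: nn_integral_cmult nn_integral_sum)
  also have "\<dots> \<le> ennreal \<epsilon> * (\<Sum>i\<in>(Basis :: 'a set). 1)"
    by (intro mult_left_mono sum_mono m) auto
  also have "\<dots> = ennreal (\<epsilon> * DIM('a))"
    using \<epsilon> by (simp add: ennreal_mult ennreal_of_nat_eq_real_of_nat)
  finally show ?thesis .
qed

section \<open>Balls inside the polytopes and the symmetrized kernel\<close>

lemma inradius_bdd: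
  fixes S :: "'a::euclidean_space set"
  assumes "S \<subseteq> cball x \<delta>" "0 \<le> \<delta>"
  shows "bdd_above {r. 0 \<le> r \<and> ball x r \<subseteq> S}" "0 \<le> inradius S x"
proof -
  show bdd: "bdd_above {r. 0 \<le> r \<and> ball x r \<subseteq> S}"
  proof (rule bdd_aboveI[of _ \<delta>])
    fix r assume "r \<in> {r. 0 \<le> r \<and> ball x r \<subseteq> S}"
    then have "ball x r \<subseteq> cball x \<delta>" using assms by auto
    then show "r \<le> \<delta>" using assms(2) by (auto simp: ball_subset_cball_iff)
  qed
  \<comment> \<open>Radius 0 always qualifies because \<open>ball x 0\<close> is empty, so the
    supremum runs over a nonempty bounded set.\<close>
  show "0 \<le> inradius S x" unfolding inradius_def by (intro cSup_upper bdd) auto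
qed

lemma mem_if_less_inradius:
  assumes "dist x y < inradius S x"
  shows "y \<in> S"
proof -
  obtain r where "ball x r \<subseteq> S" "dist x y < r"
    using less_cSupE[OF assms[unfolded inradius_def]] by force
  then show ?thesis by auto
qed

lemma rlow_le_inradius:
  assumes "\<And>x. x \<in> \<Omega> \<Longrightarrow> P x \<subseteq> cball x \<delta>" "0 \<le> \<delta>" "x \<in> \<Omega>"
  shows "rlow \<Omega> P \<le> inradius (P x) x"
  unfolding rlow_def
  by (intro cINF_lower bdd_belowI2[of _ 0] inradius_bdd(2)[of _ _ \<delta>] assms)

lemma sym_kernel_le: "(\<And>t. 0 \<le> \<gamma> t) \<Longrightarrow> sym_kernel \<gamma> P x y \<le> \<gamma> (norm (y - x))"
  by (simp add: sym_kernel_def trunc_kernel_def norm_minus_commute[of x y])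

text \<open>\<open>rlow\<close> is an infimum over \<open>\<Omega>\<close>, so both points are taken
  there: then each lies in the polytope of the other, and the two halves add up to the full
  kernel.\<close>

lemma sym_kernel_eq:
  assumes "\<And>x. x \<in> \<Omega> \<Longrightarrow> P x \<subseteq> cball x \<delta>" "0 \<le> \<delta>" "x \<in> \<Omega>" "y \<in> \<Omega>" "norm (y - x) < rlow \<Omega> P"
  shows "sym_kernel \<gamma> P x y = \<gamma> (norm (y - x))"
proof -
  have "y \<in> P x" "x \<in> P y"
    using rlow_le_inradius[of \<Omega> P \<delta> x, OF assms(1,2)] rlow_le_inradius[of \<Omega> P \<delta> y, OF assms(1,2)] assms(3-5)
    by (auto intro!: mem_if_less_inradius[of x y] mem_if_less_inradius[of y x]
        simp: dist_norm norm_minus_commute[of x y])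
  then show ?thesis by (simp add: sym_kernel_def trunc_kernel_def norm_minus_commute[of x y])
qed

section \<open>Moments of the full and the truncated kernel\<close>

lemma moment_eq_1:
  fixes i :: "'a::euclidean_space"
  assumes \<gamma>: "\<And>t. 0 \<le> \<gamma> t" "\<And>t. t > \<delta> \<Longrightarrow> \<gamma> t = 0"
    and int: "((\<lambda>z::'a. (z \<bullet> i)\<^sup>2 * \<gamma> (norm z)) has_integral 1) (cball 0 \<delta>)"
  shows "(\<integral>\<^sup>+z. ennreal ((z \<bullet> i)\<^sup>2 * \<gamma> (norm z)) \<partial>lborel) = 1"
proof -
  have "(\<integral>\<^sup>+z. ennreal ((z \<bullet> i)\<^sup>2 * \<gamma> (norm z)) * indicator (cball 0 \<delta>) z \<partial>lborel) = ennreal 1"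
    by (rule nn_integral_has_integral_lebesgue'[OF _ int]) (use \<gamma> in auto)
  moreover have "(\<integral>\<^sup>+z. ennreal ((z \<bullet> i)\<^sup>2 * \<gamma> (norm z)) * indicator (cball 0 \<delta>) z \<partial>lborel)
      = (\<integral>\<^sup>+z. ennreal ((z \<bullet> i)\<^sup>2 * \<gamma> (norm z)) \<partial>lborel)"
    using \<gamma>(2) by (intro nn_integral_cong) (auto split: split_indicator)
  ultimately show ?thesis by simp
qed

text \<open>The truncation is strict, as only points strictly within the inradius are known to lie
  in the polytope. The closed ball of the moment condition differs from it by a sphere, a null
  set.\<close>

lemma truncated_moment_eq:
  fixes i :: "'a::euclidean_space"
  assumes [measurable]: "\<gamma> \<in> borel_measurable borel" and \<gamma>: "\<And>t. 0 \<le> \<gamma> t"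
    and fin: "(\<integral>\<^sup>+z. ennreal ((z \<bullet> i)\<^sup>2 * \<gamma> (norm z)) \<partial>lborel) < \<infinity>"
  shows "(\<integral>\<^sup>+z. ennreal ((z \<bullet> i)\<^sup>2 * (if norm z < r then \<gamma> (norm z) else 0)) \<partial>lborel)
    = ennreal (integral (cball 0 r) (\<lambda>z. (z \<bullet> i)\<^sup>2 * \<gamma> (norm z)))"
proof -
  define f where "f z = (if z \<in> cball 0 r then (z \<bullet> i)\<^sup>2 * \<gamma> (norm z) else 0)" for z :: 'a
  have [measurable]: "f \<in> borel_measurable borel" unfolding f_def[abs_def] mem_cball_0 by measurable
  have "sphere 0 r \<in> null_sets (lborel :: 'a measure)"
    using negligible_sphere[of "0 :: 'a" r]
    by (subst null_sets_completion_iff[symmetric]) (auto simp: negligible_iff_null_sets)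
  then have ae: "AE z in (lborel :: 'a measure). z \<notin> sphere 0 r" by (rule AE_not_in)
  have "(\<integral>\<^sup>+z. ennreal ((z \<bullet> i)\<^sup>2 * (if norm z < r then \<gamma> (norm z) else 0)) \<partial>lborel) = (\<integral>\<^sup>+z. ennreal (f z) \<partial>lborel)"
    by (rule nn_integral_cong_AE, use ae in eventually_elim) (auto simp: f_def)
  also have "\<dots> = ennreal (integral UNIV f)"
  proof (rule nn_integral_lborel_eq_integral)
    have "(\<integral>\<^sup>+z. ennreal (f z) \<partial>lborel) \<le> (\<integral>\<^sup>+z. ennreal ((z \<bullet> i)\<^sup>2 * \<gamma> (norm z)) \<partial>lborel)"
      using \<gamma> by (intro nn_integral_mono ennreal_leI) (auto simp: f_def)
    then show "(\<integral>\<^sup>+z. ennreal (f z) \<partial>lborel) < \<infinity>" using fin by (rule le_less_trans)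
  qed (use \<gamma> in \<open>auto simp: f_def\<close>)
  also have "integral UNIV f = integral (cball 0 r) (\<lambda>z. (z \<bullet> i)\<^sup>2 * \<gamma> (norm z))"
    unfolding f_def by (rule integral_restrict_UNIV)
  finally show ?thesis .
qed

text \<open>The sets consist of the points at distance at least \<open>1 / Suc n\<close> from the
  complement, written so that they are visibly closed. They increase to \<open>\<Omega>\<close>
  because it is open, and \<open>w\<close> vanishes elsewhere, so monotone convergence recovers the
  whole energy.\<close>

lemma interior_energy_tendsto:
  fixes w :: "'a::euclidean_space \<Rightarrow> 'a"
  assumes \<Omega>: "open \<Omega>" and [measurable]: "w \<in> borel_measurable borel" and w_zero: "\<And>x. x \<notin> \<Omega> \<Longrightarrow> w x = 0"
  shows "(\<lambda>n. \<integral>\<^sup>+x\<in>- (\<Union>y\<in>- \<Omega>. ball y (1 / Suc n)). ennreal ((norm (w x))\<^sup>2) \<partial>lborel) \<longlonglongrightarrow> L2sq w"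
proof -
  define S where "S n = - (\<Union>y\<in>- \<Omega>. ball y (1 / Suc n))" for n
  have [measurable]: "S n \<in> sets borel" for n
    unfolding S_def by (intro borel_closed) auto
  have "incseq S"
  proof (rule incseq_SucI)
    fix n
    have "ball y (1 / Suc (Suc n)) \<subseteq> ball y (1 / Suc n)" for y :: 'a
      by (intro subset_ball) (simp add: frac_le)
    then show "S n \<subseteq> S (Suc n)" unfolding S_def by blast
  qed
  then have inc: "incseq (\<lambda>n x. ennreal ((norm (w x))\<^sup>2) * indicator (S n) x)"
    by (auto simp: incseq_def le_fun_def split: split_indicator)
  have UN: "(\<Union>n. S n) = \<Omega>"
  proof
    show "(\<Union>n. S n) \<subseteq> \<Omega>" unfolding S_def by force
    show "\<Omega> \<subseteq> (\<Union>n. S n)"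
    proof
      fix x assume "x \<in> \<Omega>"
      then obtain e where e: "e > 0" "ball x e \<subseteq> \<Omega>" using \<Omega> open_contains_ball by blast
      obtain n where "1 / real (Suc n) < e" using nat_approx_posE[OF e(1)] by auto
      then have "x \<in> S n" using e(2) unfolding S_def by (force simp: dist_commute)
      then show "x \<in> (\<Union>n. S n)" by blast
    qed
  qed
  have "(\<lambda>n. \<integral>\<^sup>+x. ennreal ((norm (w x))\<^sup>2) * indicator (S n) x \<partial>lborel) \<longlonglongrightarrow> L2sq w"
    unfolding L2sq_def
  proof (rule nn_integral_LIMSEQ[OF inc])
    fix x
    have "(\<lambda>n. indicator (S n) x :: ennreal) \<longlonglongrightarrow> indicator \<Omega> x"
      using LIMSEQ_indicator_incseq[OF \<open>incseq S\<close>, of x] by (simp add: UN)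
    from ennreal_tendsto_cmult[OF _ this, of "ennreal ((norm (w x))\<^sup>2)"]
    show "(\<lambda>n. ennreal ((norm (w x))\<^sup>2) * indicator (S n) x) \<longlonglongrightarrow> ennreal ((norm (w x))\<^sup>2)"
      using w_zero[of x] by (auto split: split_indicator_asm)
  qed measurable
  then show ?thesis by (simp add: S_def)
qed

text \<open>
  The maps \<open>P k\<close> need not depend measurably on the base point, so the inner integral of the energy
  is only sandwiched between the measurable energies of \<open>\<gamma> k\<close> and of its truncation at
  \<open>rlow \<Omega> (P k)\<close>.
\<close>

lemma energy_upper_bound:
  fixes u :: "'a::euclidean_space \<Rightarrow> real"
  assumes [measurable]: "u \<in> borel_measurable borel" "\<gamma> \<in> borel_measurable borel" and \<gamma>: "\<And>t. 0 \<le> \<gamma> t"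
  shows "(\<integral>\<^sup>+x\<in>D. (\<integral>\<^sup>+y\<in>D. ennreal ((u y - u x)\<^sup>2 * sym_kernel \<gamma> P x y) \<partial>lborel) \<partial>lborel)
    \<le> (\<integral>\<^sup>+x\<in>UNIV. (\<integral>\<^sup>+z. ennreal ((u (x + z) - u x)\<^sup>2 * \<gamma> (norm z)) \<partial>lborel) \<partial>lborel)"
proof (rule nn_integral_mono)
  fix x
  have "(\<integral>\<^sup>+y\<in>D. ennreal ((u y - u x)\<^sup>2 * sym_kernel \<gamma> P x y) \<partial>lborel)
      \<le> (\<integral>\<^sup>+y. ennreal ((u y - u x)\<^sup>2 * \<gamma> (norm (y - x))) \<partial>lborel)"
    using sym_kernel_le[of \<gamma> P x, OF \<gamma>]
    by (intro nn_integral_mono) (auto intro!: ennreal_leI mult_left_mono split: split_indicator)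
  also have "\<dots> = (\<integral>\<^sup>+z. ennreal ((u (x + z) - u x)\<^sup>2 * \<gamma> (norm z)) \<partial>lborel)"
    using nn_integral_lborel_translate[of "\<lambda>y. ennreal ((u y - u x)\<^sup>2 * \<gamma> (norm (y - x)))" x]
    by (simp add: add.commute[of _ x])
  finally show "(\<integral>\<^sup>+y\<in>D. ennreal ((u y - u x)\<^sup>2 * sym_kernel \<gamma> P x y) \<partial>lborel) * indicator D x
      \<le> (\<integral>\<^sup>+z. ennreal ((u (x + z) - u x)\<^sup>2 * \<gamma> (norm z)) \<partial>lborel) * indicator UNIV x"
    by (auto split: split_indicator)
qed

lemma energy_lower_bound:
  fixes u :: "'a::euclidean_space \<Rightarrow> real"
  assumes [measurable]: "u \<in> borel_measurable borel" "\<gamma> \<in> borel_measurable borel"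
    and \<gamma>_zero: "\<And>t. \<eta> \<le> t \<Longrightarrow> \<gamma> t = 0"
    and P: "\<And>x. x \<in> \<Omega> \<Longrightarrow> P x \<subseteq> cball x \<delta>" and \<delta>: "0 \<le> \<delta>" and D: "\<Omega> \<subseteq> D" and \<eta>: "0 < \<eta>"
  shows "(\<integral>\<^sup>+x\<in>- (\<Union>y\<in>- \<Omega>. ball y \<eta>).
      (\<integral>\<^sup>+z. ennreal ((u (x + z) - u x)\<^sup>2 * (if norm z < rlow \<Omega> P then \<gamma> (norm z) else 0)) \<partial>lborel) \<partial>lborel)
    \<le> (\<integral>\<^sup>+x\<in>D. (\<integral>\<^sup>+y\<in>D. ennreal ((u y - u x)\<^sup>2 * sym_kernel \<gamma> P x y) \<partial>lborel) \<partial>lborel)"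
proof (rule nn_integral_mono)
  fix x
  let ?S = "- (\<Union>y\<in>- \<Omega>. ball y \<eta>)"
  let ?\<kappa> = "\<lambda>t. if t < rlow \<Omega> P then \<gamma> t else 0"
  show "(\<integral>\<^sup>+z. ennreal ((u (x + z) - u x)\<^sup>2 * ?\<kappa> (norm z)) \<partial>lborel) * indicator ?S x
      \<le> (\<integral>\<^sup>+y\<in>D. ennreal ((u y - u x)\<^sup>2 * sym_kernel \<gamma> P x y) \<partial>lborel) * indicator D x"
  proof (cases "x \<in> ?S")
    case x: True
    \<comment> \<open>Membership in \<open>?S\<close> keeps the open ball of radius
      \<open>\<eta>\<close> around \<open>x\<close> inside \<open>\<Omega>\<close>, and
      \<open>\<gamma>\<close> vanishes from \<open>\<eta>\<close> on: only pairs in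
      \<open>\<Omega>\<close> interact.\<close>
    have near: "y \<in> \<Omega>" if "norm (y - x) < \<eta>" for y
      using x that by (auto simp: dist_norm norm_minus_commute)
    have x\<Omega>: "x \<in> \<Omega>" using near[of x] \<eta> by simp
    have "(\<integral>\<^sup>+z. ennreal ((u (x + z) - u x)\<^sup>2 * ?\<kappa> (norm z)) \<partial>lborel)
        = (\<integral>\<^sup>+y. ennreal ((u y - u x)\<^sup>2 * ?\<kappa> (norm (y - x))) \<partial>lborel)"
      using nn_integral_lborel_translate[of "\<lambda>y. ennreal ((u y - u x)\<^sup>2 * ?\<kappa> (norm (y - x)))" x]
      by (simp add: add.commute[of _ x] cong: if_cong)
    also have "\<dots> \<le> (\<integral>\<^sup>+y\<in>D. ennreal ((u y - u x)\<^sup>2 * sym_kernel \<gamma> P x y) \<partial>lborel)"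
    proof (rule nn_integral_mono)
      fix y
      show "ennreal ((u y - u x)\<^sup>2 * ?\<kappa> (norm (y - x)))
          \<le> ennreal ((u y - u x)\<^sup>2 * sym_kernel \<gamma> P x y) * indicator D y"
      proof (cases "norm (y - x) < rlow \<Omega> P \<and> norm (y - x) < \<eta>")
        case True
        then have "y \<in> \<Omega>" using near by simp
        then show ?thesis
          using True D sym_kernel_eq[OF P \<delta> x\<Omega>, of y \<gamma>] by auto
      next
        case False
        then have "?\<kappa> (norm (y - x)) = 0" using \<gamma>_zero by auto
        then show ?thesis by simp
      qed
    qed
    finally show ?thesis using x x\<Omega> D by (auto simp: indicator_def)
  qed simp
qed

section \<open>Squeezing and passage to the limit\<close>

lemma ennreal_mult_add:
  "0 \<le> a \<Longrightarrow> 0 \<le> b \<Longrightarrow> 0 \<le> c \<Longrightarrow> ennreal a * ennreal b + ennreal c = ennreal (a * b + c)"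
  by (simp add: ennreal_mult)

text \<open>\<open>E k\<close> may be infinite a priori; the upper bound makes it eventually finite,
  so the comparison happens in the reals. In the lower bound, \<open>1 - \<tau>\<close> accounts for
  the truncated moments and \<open>W - \<tau>\<close> for the removed boundary strip.\<close>

lemma tendsto_ennreal_if_squeezed:
  assumes W: "0 \<le> W" and c: "0 \<le> c"
    and upper: "\<And>\<tau>. 0 < \<tau> \<Longrightarrow> \<tau> < 1 \<Longrightarrow> \<forall>\<^sub>F k in F. E k \<le> ennreal ((1 + \<tau>) * W + 2 * \<tau> * c)"
    and lower: "\<And>\<tau>. 0 < \<tau> \<Longrightarrow> \<tau> < 1 \<Longrightarrow>
      \<forall>\<^sub>F k in F. ennreal ((1 - \<tau>) * (W - \<tau>)) \<le> ennreal (1 + \<tau>) * E k + ennreal (2 * \<tau> * c)"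
  shows "(E \<longlongrightarrow> ennreal W) F"
proof -
  \<comment> \<open>Solving the lower bound for \<open>E k\<close> leaves a term
    \<open>\<tau> * E k\<close>, at most \<open>\<tau> * (2 * W + 2 * c)\<close> by the upper bound.
    Adding \<open>\<tau> * W\<close>, \<open>2 * \<tau> * c\<close> and \<open>\<tau>\<close> gives
    these coefficients.\<close>
  define C where "C = 3 * W + 4 * c + 1"
  have C: "C > 0" using W c by (simp add: C_def)
  have close: "\<forall>\<^sub>F k in F. E k < top \<and> \<bar>enn2real (E k) - W\<bar> \<le> \<tau> * C" if \<tau>: "0 < \<tau>" "\<tau> < 1" for \<tau>
    using upper[OF \<tau>] lower[OF \<tau>]
  proof eventually_elim
    case (elim k)
    define e where "e = enn2real (E k)"
    have fin: "E k < top" using elim(1) by (auto intro: le_less_trans)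
    then have E: "E k = ennreal e" "0 \<le> e" by (simp_all add: e_def)
    have nonneg: "0 \<le> (1 + \<tau>) * W + 2 * \<tau> * c" using W c \<tau> by simp
    have up: "e \<le> (1 + \<tau>) * W + 2 * \<tau> * c" using elim(1) nonneg by (simp add: E)
    have "ennreal ((1 - \<tau>) * (W - \<tau>)) \<le> ennreal ((1 + \<tau>) * e + 2 * \<tau> * c)"
      using elim(2) \<tau> c E ennreal_mult_add[of "1 + \<tau>" e "2 * \<tau> * c"] by (simp del: ennreal_plus)
    then have low: "(1 - \<tau>) * (W - \<tau>) \<le> (1 + \<tau>) * e + 2 * \<tau> * c"
      using E \<tau> c by (subst (asm) ennreal_le_iff) auto
    have W\<tau>: "\<tau> * W \<le> W" "\<tau> * c \<le> c" "0 \<le> \<tau> * W" "0 \<le> \<tau> * c"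
      using W c \<tau> by (simp_all add: mult_left_le_one_le)
    have "e \<le> 2 * W + 2 * c" using up W\<tau> by (simp add: algebra_simps)
    then have "\<tau> * e \<le> \<tau> * (2 * W + 2 * c)" using \<tau> by (intro mult_left_mono) auto
    then have "\<tau> * e \<le> 2 * (\<tau> * W) + 2 * (\<tau> * c)" by (simp add: algebra_simps)
    moreover have "W - \<tau> * W - \<tau> + \<tau> * \<tau> \<le> e + \<tau> * e + 2 * (\<tau> * c)"
      using low by (simp add: algebra_simps)
    moreover have "e \<le> W + \<tau> * W + 2 * (\<tau> * c)" using up by (simp add: algebra_simps)
    moreover have "\<tau> * C = 3 * (\<tau> * W) + 4 * (\<tau> * c) + \<tau>" by (simp add: C_def algebra_simps)
    moreover have "0 \<le> \<tau> * \<tau>" by simp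
    ultimately have "W - e \<le> \<tau> * C" "e - W \<le> \<tau> * C"
      using W\<tau> \<tau> by linarith+
    then show ?case using fin by (simp add: e_def abs_le_iff)
  qed
  have "((\<lambda>k. enn2real (E k)) \<longlongrightarrow> W) F"
  proof (rule tendstoI)
    fix r :: real assume r: "r > 0"
    define \<tau> where "\<tau> = min (1 / 2) (r / (2 * C))"
    have \<tau>: "0 < \<tau>" "\<tau> < 1" using r C by (auto simp: \<tau>_def)
    have "\<tau> * C \<le> r / (2 * C) * C" using C by (intro mult_right_mono) (auto simp: \<tau>_def)
    also have "\<dots> < r" using r C by simp
    finally have "\<tau> * C < r" .
    with close[OF \<tau>] show "\<forall>\<^sub>F k in F. dist (enn2real (E k)) W < r"
      by (auto elim!: eventually_mono simp: dist_real_def)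
  qed
  then have "((\<lambda>k. ennreal (enn2real (E k))) \<longlongrightarrow> ennreal W) F" by (rule tendsto_ennrealI)
  moreover have "\<forall>\<^sub>F k in F. ennreal (enn2real (E k)) = E k"
    using close[of "1 / 2"] by (auto elim!: eventually_mono)
  ultimately show ?thesis by (rule Lim_transform_eventually)
qed

theorem theoremA3:
  fixes \<Omega> :: "'a::euclidean_space set"
    and \<delta> :: "nat \<Rightarrow> real" and \<delta>0 :: real
    and \<gamma> :: "nat \<Rightarrow> real \<Rightarrow> real"
    and P :: "nat \<Rightarrow> 'a \<Rightarrow> 'a set"
    and u :: "'a \<Rightarrow> real" and g :: "'a \<Rightarrow> 'a"
    and D :: "'a set"
  assumes \<Omega>: "open \<Omega>" "bounded \<Omega>"
    and \<delta>_pos: "\<And>k. 0 < \<delta> k"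
    and \<delta>_dec: "decseq \<delta>"
    and \<delta>_lim: "\<delta> \<longlonglongrightarrow> 0"
    and \<delta>_le: "\<And>k. \<delta> k \<le> \<delta>0"
    and D_def: "D = \<Omega> \<union> {y. y \<notin> \<Omega> \<and> infdist y (frontier \<Omega>) < \<delta>0}"
    and \<gamma>_meas: "\<And>k. \<gamma> k \<in> borel_measurable borel"
    and \<gamma>_nonneg: "\<And>k t. 0 \<le> \<gamma> k t"
    and \<gamma>_pos: "\<And>k t. 0 \<le> t \<Longrightarrow> t < \<delta> k \<Longrightarrow> 0 < \<gamma> k t"
    and \<gamma>_zero: "\<And>k t. t > \<delta> k \<Longrightarrow> \<gamma> k t = 0"
    and \<gamma>_moment: "\<And>k i. i \<in> Basis \<Longrightarrow>
        ((\<lambda>z::'a. (z \<bullet> i)\<^sup>2 * \<gamma> k (norm z)) has_integral 1) (cball 0 (\<delta> k))"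
    and P_poly: "\<And>k x. x \<in> D \<Longrightarrow> polytope (P k x) \<and> P k x \<subseteq> cball x (\<delta> k)"
    and r_lim: "\<And>i. i \<in> Basis \<Longrightarrow>
        (\<lambda>k. integral (cball 0 (rlow \<Omega> (P k))) (\<lambda>z::'a. (z \<bullet> i)\<^sup>2 * \<gamma> k (norm z))) \<longlonglongrightarrow> 1"
    and u_H10: "H10 \<Omega> u"
    and u_zero: "\<And>x. x \<notin> \<Omega> \<Longrightarrow> u x = 0"
    and u_H1: "H1_weak_grad D u g"
  shows "(\<lambda>k. \<integral>\<^sup>+x\<in>D. (\<integral>\<^sup>+y\<in>D. ennreal ((u y - u x)\<^sup>2 * sym_kernel (\<gamma> k) (P k) x y) \<partial>lborel) \<partial>lborel)
           \<longlonglongrightarrow> (\<integral>\<^sup>+x\<in>D. ennreal ((norm (g x))\<^sup>2) \<partial>lborel)"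
proof -
  have \<delta>0: "\<delta>0 > 0" using \<delta>_pos[of 0] \<delta>_le[of 0] by linarith
  \<comment> \<open>Dropping \<open>y \<notin> \<Omega>\<close> leaves the union unchanged and
    exhibits \<open>D\<close> as a union of two open sets.\<close>
  have "D = \<Omega> \<union> {y. infdist y (frontier \<Omega>) < \<delta>0}" unfolding D_def by auto
  moreover have "open {y. infdist y (frontier \<Omega>) < \<delta>0}"
    by (intro open_Collect_less continuous_intros)
  ultimately have D: "open D" "\<Omega> \<subseteq> D" using \<Omega>(1) by auto
  have u [measurable]: "u \<in> borel_measurable borel" using u_H10 by (simp add: H10_def)
  note [measurable] = \<gamma>_meas
  obtain w where w [measurable]: "w \<in> borel_measurable borel" and w_zero: "\<And>x. x \<notin> \<Omega> \<Longrightarrow> w x = 0"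
    and fin: "L2sq w < \<infinity>" "L2sq u < \<infinity>" and du: "L2_differentiable u w"
    by (rule H10_L2_differentiable[OF \<Omega>(1) u_H10]) (rule u_zero, assumption, rule that)
  have gw: "AE x in lborel. x \<in> D \<longrightarrow> g x = w x"
    by (rule weak_gradient_AE_eq[OF D(1) u_H1 _ _ w fin(2,1) du]) (use u_zero w_zero D(2) in auto)
  define W where "W = enn2real (L2sq w)"
  have W: "L2sq w = ennreal W" "0 \<le> W" using fin(1) by (simp_all add: W_def)
  have rhs: "(\<integral>\<^sup>+x\<in>D. ennreal ((norm (g x))\<^sup>2) \<partial>lborel) = ennreal W"
    unfolding W(1)[symmetric] L2sq_def
    by (rule nn_integral_cong_AE, use gw in eventually_elim) (use w_zero D(2) in \<open>auto split: split_indicator\<close>)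
  define E where "E k = (\<integral>\<^sup>+x\<in>D. (\<integral>\<^sup>+y\<in>D. ennreal ((u y - u x)\<^sup>2 * sym_kernel (\<gamma> k) (P k) x y) \<partial>lborel) \<partial>lborel)" for k
  define \<kappa> where "\<kappa> k t = (if t < rlow \<Omega> (P k) then \<gamma> k t else 0)" for k t
  define m where "m k i = integral (cball 0 (rlow \<Omega> (P k))) (\<lambda>z::'a. (z \<bullet> i)\<^sup>2 * \<gamma> k (norm z))" for k i
  have \<kappa>_meas [measurable]: "\<kappa> k \<in> borel_measurable borel" for k unfolding \<kappa>_def[abs_def] by measurable
  have \<kappa>_nonneg: "0 \<le> \<kappa> k t" for k t by (simp add: \<kappa>_def \<gamma>_nonneg)
  have mom\<gamma>: "(\<integral>\<^sup>+z. ennreal ((z \<bullet> i)\<^sup>2 * \<gamma> k (norm z)) \<partial>(lborel :: 'a measure)) = ennreal 1" if "i \<in> Basis" for k i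
    using moment_eq_1[OF \<gamma>_nonneg \<gamma>_zero \<gamma>_moment[OF that]] by simp
  have mom\<kappa>: "(\<integral>\<^sup>+z. ennreal ((z \<bullet> i)\<^sup>2 * \<kappa> k (norm z)) \<partial>(lborel :: 'a measure)) = ennreal (m k i)" if "i \<in> Basis" for k i
    unfolding \<kappa>_def m_def
    by (rule truncated_moment_eq) (use mom\<gamma>[OF that] in \<open>auto simp: \<gamma>_nonneg\<close>)
  have m_nonneg: "0 \<le> m k i" for k i
    unfolding m_def
    by (cases "(\<lambda>z::'a. (z \<bullet> i)\<^sup>2 * \<gamma> k (norm z)) integrable_on cball 0 (rlow \<Omega> (P k))")
      (auto intro!: Henstock_Kurzweil_Integration.integral_nonneg simp: \<gamma>_nonneg not_integrable_integral)
  have sum_sq: "(\<Sum>i\<in>Basis. (a \<bullet> i)\<^sup>2) = (norm a)\<^sup>2" for a :: 'a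
    unfolding power2_norm_eq_inner by (subst euclidean_inner) (simp add: power2_eq_square)
  have ev_small: "\<forall>\<^sub>F k in sequentially. \<delta> k < \<eta>" if "\<eta> > 0" for \<eta>
    using order_tendstoD(2)[OF \<delta>_lim that] .
  have meas1: "(\<lambda>(x, z). u (x + z) - u x) \<in> borel_measurable (borel \<Otimes>\<^sub>M borel)"
    "(\<lambda>(x, z). w x \<bullet> z) \<in> borel_measurable (borel \<Otimes>\<^sub>M borel)" by measurable
  \<comment> \<open>The linearization error is chosen as \<open>\<tau>\<^sup>2\<close> so that it
    stays of order \<open>\<tau>\<close> after multiplication by
    \<open>1 + 1 / \<tau>\<close>.\<close>
  have const: "(1 + 1 / \<tau>) * (\<tau>\<^sup>2 * DIM('a)) \<le> 2 * \<tau> * DIM('a)" if "0 < \<tau>" "\<tau> < 1" for \<tau> :: real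
  proof -
    have "(1 + 1 / \<tau>) * \<tau>\<^sup>2 = \<tau> * \<tau> + \<tau>" using that by (simp add: field_simps power2_eq_square)
    also have "\<dots> \<le> 2 * \<tau>" using that mult_right_mono[of \<tau> 1 \<tau>] by simp
    finally have "(1 + 1 / \<tau>) * \<tau>\<^sup>2 * DIM('a) \<le> 2 * \<tau> * DIM('a)" by (rule mult_right_mono) simp
    then show ?thesis by (simp only: mult.assoc)
  qed
  have "(E \<longlongrightarrow> ennreal W) sequentially"
  proof (rule tendsto_ennreal_if_squeezed[where c = "real DIM('a)", OF W(2)])
    fix \<tau> :: real assume \<tau>: "0 < \<tau>" "\<tau> < 1"
    obtain \<eta>1 where \<eta>1: "\<eta>1 > 0" "\<And>z. norm z < \<eta>1 \<Longrightarrow>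
        L2sq (\<lambda>x. u (x + z) - u x - w x \<bullet> z) \<le> ennreal (\<tau>\<^sup>2 * (norm z)\<^sup>2)"
      using du[unfolded L2_differentiable_def, rule_format, of "\<tau>\<^sup>2"] \<tau> by auto
    have \<gamma>_van: "\<gamma> k t = 0" if "\<delta> k < \<eta>" "\<eta> \<le> t" for k t \<eta> using \<gamma>_zero that by auto
    have \<tau>2: "0 \<le> \<tau>\<^sup>2" by simp
    have err\<gamma>: "ennreal (1 + 1 / \<tau>) * (\<integral>\<^sup>+x. (\<integral>\<^sup>+z. ennreal ((u (x + z) - u x - w x \<bullet> z)\<^sup>2 * \<gamma> k (norm z)) \<partial>lborel) \<partial>lborel)
        \<le> ennreal (2 * \<tau> * DIM('a))" if "\<delta> k < \<eta>1" for k
    proof -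
      have "(\<integral>\<^sup>+x. (\<integral>\<^sup>+z. ennreal ((u (x + z) - u x - w x \<bullet> z)\<^sup>2 * \<gamma> k (norm z)) \<partial>lborel) \<partial>lborel)
          \<le> ennreal (\<tau>\<^sup>2 * DIM('a))"
        by (rule linearization_energy_le[OF u w \<gamma>_meas \<gamma>_nonneg \<gamma>_van[OF that] \<tau>2 \<eta>1(2)]) (simp_all add: mom\<gamma>)
      then have "ennreal (1 + 1 / \<tau>) * (\<integral>\<^sup>+x. (\<integral>\<^sup>+z. ennreal ((u (x + z) - u x - w x \<bullet> z)\<^sup>2 * \<gamma> k (norm z)) \<partial>lborel) \<partial>lborel)
          \<le> ennreal (1 + 1 / \<tau>) * ennreal (\<tau>\<^sup>2 * DIM('a))"
        by (rule mult_left_mono) simp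
      also have "\<dots> \<le> ennreal (2 * \<tau> * DIM('a))"
        using const[OF \<tau>] \<tau> by (simp add: ennreal_mult'[symmetric] ennreal_leI del: ennreal_plus)
      finally show ?thesis .
    qed
    show "\<forall>\<^sub>F k in sequentially. E k \<le> ennreal ((1 + \<tau>) * W + 2 * \<tau> * real DIM('a))"
      using ev_small[OF \<eta>1(1)]
    proof eventually_elim
      case (elim k)
      have "E k \<le> (\<integral>\<^sup>+x\<in>UNIV. (\<integral>\<^sup>+z. ennreal ((u (x + z) - u x)\<^sup>2 * \<gamma> k (norm z)) \<partial>lborel) \<partial>lborel)"
        unfolding E_def by (rule energy_upper_bound[OF u \<gamma>_meas \<gamma>_nonneg])
      also have "\<dots> \<le> ennreal (1 + \<tau>) * (\<integral>\<^sup>+x\<in>UNIV. (\<integral>\<^sup>+z. ennreal ((w x \<bullet> z)\<^sup>2 * \<gamma> k (norm z)) \<partial>lborel) \<partial>lborel)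
          + ennreal (1 + 1 / \<tau>) * (\<integral>\<^sup>+x. (\<integral>\<^sup>+z. ennreal ((u (x + z) - u x - w x \<bullet> z)\<^sup>2 * \<gamma> k (norm z)) \<partial>lborel) \<partial>lborel)"
        by (rule energy_le_perturbed[OF meas1 \<gamma>_meas _ \<gamma>_nonneg \<tau>(1)]) simp
      also have "\<dots> \<le> ennreal (1 + \<tau>) * (\<integral>\<^sup>+x\<in>UNIV. (\<integral>\<^sup>+z. ennreal ((w x \<bullet> z)\<^sup>2 * \<gamma> k (norm z)) \<partial>lborel) \<partial>lborel)
          + ennreal (2 * \<tau> * DIM('a))"
        by (intro add_left_mono err\<gamma> elim)
      also have "(\<integral>\<^sup>+x\<in>UNIV. (\<integral>\<^sup>+z. ennreal ((w x \<bullet> z)\<^sup>2 * \<gamma> k (norm z)) \<partial>lborel) \<partial>lborel) = ennreal W"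
        unfolding W(1)[symmetric] L2sq_def
        by (intro nn_integral_cong) (simp add: radial_second_moment[OF \<gamma>_meas \<gamma>_nonneg mom\<gamma>] sum_sq)
      also have "ennreal (1 + \<tau>) * ennreal W + ennreal (2 * \<tau> * DIM('a)) = ennreal ((1 + \<tau>) * W + 2 * \<tau> * DIM('a))"
        using \<tau> W by (intro ennreal_mult_add) auto
      finally show ?case .
    qed
    define S where "S n = - (\<Union>y\<in>- \<Omega>. ball y (1 / Suc n))" for n
    have S_meas [measurable]: "S n \<in> sets borel" for n unfolding S_def by (intro borel_closed) auto
    have S_lim: "(\<lambda>n. \<integral>\<^sup>+x\<in>S n. ennreal ((norm (w x))\<^sup>2) \<partial>lborel) \<longlonglongrightarrow> ennreal W"
      using interior_energy_tendsto[OF \<Omega>(1) w w_zero] unfolding S_def W(1) .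
    \<comment> \<open>For \<open>W < \<tau>\<close> the left side is cut off to 0 and any
      \<open>n\<close> serves; otherwise the interior energies eventually exceed
      \<open>W - \<tau>\<close>.\<close>
    obtain n where n: "ennreal (W - \<tau>) \<le> (\<integral>\<^sup>+x\<in>S n. ennreal ((norm (w x))\<^sup>2) \<partial>lborel)"
    proof (cases "W - \<tau> < 0")
      case True
      then show thesis using that[of 0] by (simp add: ennreal_neg)
    next
      case False
      then have "ennreal (W - \<tau>) < ennreal W" using \<tau> by (simp add: ennreal_less_iff)
      from order_tendstoD(1)[OF S_lim this] show thesis
        using that by (auto simp: eventually_sequentially intro: less_imp_le)
    qed
    \<comment> \<open>The strip width is fixed before \<open>k\<close>; once
      \<open>\<delta> k < \<eta>\<close>, interactions starting in \<open>S n\<close> do not leave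
      \<open>\<Omega>\<close>.\<close>
    define \<eta> where "\<eta> = 1 / real (Suc n)"
    have \<eta>: "\<eta> > 0" by (simp add: \<eta>_def)
    have ev_m: "\<forall>\<^sub>F k in sequentially. \<forall>i\<in>Basis. 1 - \<tau> < m k i"
      using order_tendstoD(1)[OF r_lim] \<tau> unfolding m_def by (intro eventually_ball_finite) auto
    show "\<forall>\<^sub>F k in sequentially. ennreal ((1 - \<tau>) * (W - \<tau>)) \<le> ennreal (1 + \<tau>) * E k + ennreal (2 * \<tau> * real DIM('a))"
      using ev_small[OF \<eta>1(1)] ev_small[OF \<eta>] ev_m
    proof eventually_elim
      case (elim k)
      have "ennreal ((1 - \<tau>) * (W - \<tau>)) = ennreal (1 - \<tau>) * ennreal (W - \<tau>)"
        using \<tau> by (simp add: ennreal_mult')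
      also have "\<dots> \<le> ennreal (1 - \<tau>) * (\<integral>\<^sup>+x\<in>S n. ennreal ((norm (w x))\<^sup>2) \<partial>lborel)"
        using n by (rule mult_left_mono) simp
      also have "\<dots> = (\<integral>\<^sup>+x\<in>S n. ennreal ((1 - \<tau>) * (norm (w x))\<^sup>2) \<partial>lborel)"
        using \<tau> by (simp add: ennreal_mult' nn_integral_cmult[symmetric] mult.assoc)
      also have "\<dots> \<le> (\<integral>\<^sup>+x\<in>S n. (\<integral>\<^sup>+z. ennreal ((w x \<bullet> z)\<^sup>2 * \<kappa> k (norm z)) \<partial>lborel) \<partial>lborel)"
      proof (intro nn_integral_mono mult_right_mono)
        fix x
        have "(1 - \<tau>) * (norm (w x))\<^sup>2 = (\<Sum>i\<in>Basis. (w x \<bullet> i)\<^sup>2 * (1 - \<tau>))"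
          by (simp add: sum_sq[symmetric] sum_distrib_left mult.commute)
        also have "\<dots> \<le> (\<Sum>i\<in>Basis. (w x \<bullet> i)\<^sup>2 * m k i)"
          using elim(3) by (intro sum_mono mult_left_mono) (auto intro: less_imp_le)
        finally show "ennreal ((1 - \<tau>) * (norm (w x))\<^sup>2) \<le> (\<integral>\<^sup>+z. ennreal ((w x \<bullet> z)\<^sup>2 * \<kappa> k (norm z)) \<partial>lborel)"
          by (simp add: radial_second_moment[OF \<kappa>_meas \<kappa>_nonneg mom\<kappa> m_nonneg] ennreal_leI)
      qed simp
      \<comment> \<open>Here the linearization takes the place of \<open>F\<close> and the increment
        that of \<open>H\<close>, the reverse of the upper bound.\<close>
      also have "\<dots> \<le> ennreal (1 + \<tau>) * (\<integral>\<^sup>+x\<in>S n. (\<integral>\<^sup>+z. ennreal ((u (x + z) - u x)\<^sup>2 * \<kappa> k (norm z)) \<partial>lborel) \<partial>lborel)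
          + ennreal (1 + 1 / \<tau>) * (\<integral>\<^sup>+x. (\<integral>\<^sup>+z. ennreal ((w x \<bullet> z - (u (x + z) - u x))\<^sup>2 * \<kappa> k (norm z)) \<partial>lborel) \<partial>lborel)"
        by (rule energy_le_perturbed[OF meas1(2,1) \<kappa>_meas S_meas \<kappa>_nonneg \<tau>(1)])
      also have "\<dots> \<le> ennreal (1 + \<tau>) * E k + ennreal (2 * \<tau> * DIM('a))"
      proof (intro add_mono mult_left_mono)
        show "(\<integral>\<^sup>+x\<in>S n. (\<integral>\<^sup>+z. ennreal ((u (x + z) - u x)\<^sup>2 * \<kappa> k (norm z)) \<partial>lborel) \<partial>lborel) \<le> E k"
          unfolding S_def \<eta>_def[symmetric] \<kappa>_def E_def
          by (rule energy_lower_bound[OF u \<gamma>_meas \<gamma>_van[OF elim(2)] _ _ D(2) \<eta>, where \<delta> = "\<delta> k"])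
            (use P_poly D(2) \<delta>_pos[of k] in auto)
        \<comment> \<open>The truncated kernel lies below the full one, so the error estimate for
          \<open>\<gamma> k\<close> covers \<open>\<kappa> k\<close> as well.\<close>
        have "(w x \<bullet> z - (u (x + z) - u x))\<^sup>2 * \<kappa> k (norm z) \<le> (u (x + z) - u x - w x \<bullet> z)\<^sup>2 * \<gamma> k (norm z)" for x z
          unfolding power2_commute[of "w x \<bullet> z"]
          by (intro mult_left_mono) (auto simp: \<kappa>_def \<gamma>_nonneg)
        then have "(\<integral>\<^sup>+x. (\<integral>\<^sup>+z. ennreal ((w x \<bullet> z - (u (x + z) - u x))\<^sup>2 * \<kappa> k (norm z)) \<partial>lborel) \<partial>lborel)
            \<le> (\<integral>\<^sup>+x. (\<integral>\<^sup>+z. ennreal ((u (x + z) - u x - w x \<bullet> z)\<^sup>2 * \<gamma> k (norm z)) \<partial>lborel) \<partial>lborel)"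
          by (intro nn_integral_mono ennreal_leI)
        from order_trans[OF mult_left_mono[OF this] err\<gamma>[OF elim(1)]]
        show "ennreal (1 + 1 / \<tau>) * (\<integral>\<^sup>+x. (\<integral>\<^sup>+z. ennreal ((w x \<bullet> z - (u (x + z) - u x))\<^sup>2 * \<kappa> k (norm z)) \<partial>lborel) \<partial>lborel)
            \<le> ennreal (2 * \<tau> * DIM('a))" by simp
      qed simp
      finally show ?case .
    qed
  qed simp
  then show ?thesis unfolding E_def rhs .
qed

end
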